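(* Every GCOTS and every GLOTS is WRN (weakly Radon–Nikodým): that is, if a topological space $X$ is homeomorphic to a subspace of a COTS or of a LOTS, then there is a Rosenthal Banach space $V$ such that $X$ is homeomorphic to a subspace of the dual unit ball $B_{V^*}$ with the weak-star topology.
   Context: A circular order on a set $X$ is a ternary relation $R\subseteq X^3$ (write $[a,b,c]$ for $(a,b,c)\in R$) satisfying: cyclicity ($[a,b,c]\Rightarrow[b,c,a]$); asymmetry ($[a,b,c]\Rightarrow (c,b,a)\notin R$); transitivity ($[a,b,c]$ and $[a,c,d]$ imply $[a,b,d]$); totality (if $a,b,c$ are distinct then $[a,b,c]$ or $[a,c,b]$). Put $[a,b]_R:=\{x\in X:[a,x,b]\}\cup\{a,b\}$. A COTS is a topological space whose topology is the interval topology of some circular order $R$, i.e. has base $\{X\setminus[a,b]_R: a,b\in X\}\cup\{X\}$. A LOTS is a topological space whose topology is the interval topology (generated by the open rays) of some linear order. GCOTS (GLOTS): spaces homeomorphic to a subspace of a COTS (LOTS). A Banach space $V$ is Rosenthal if it does not contain an isomorphic copy of $\ell_1$. *)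

theory Defs
  imports "HOL-Analysis.Analysis" "HOL-Library.Function_Algebras"
begin

section \<open>Circularly and linearly ordered topological spaces\<close>

definition circular_order_on :: "'a set \<Rightarrow> ('a \<times> 'a \<times> 'a) set \<Rightarrow> bool" where
  "circular_order_on X R \<longleftrightarrow>
     R \<subseteq> X \<times> X \<times> X \<and>
     (\<forall>a b c. (a, b, c) \<in> R \<longrightarrow> (b, c, a) \<in> R) \<and>
     (\<forall>a b c. (a, b, c) \<in> R \<longrightarrow> (c, b, a) \<notin> R) \<and>
     (\<forall>a b c d. (a, b, c) \<in> R \<and> (a, c, d) \<in> R \<longrightarrow> (a, b, d) \<in> R) \<and>
     (\<forall>a\<in>X. \<forall>b\<in>X. \<forall>c\<in>X. a \<noteq> b \<and> b \<noteq> c \<and> a \<noteq> c \<longrightarrow> (a, b, c) \<in> R \<or> (a, c, b) \<in> R)"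

definition circular_interval :: "'a set \<Rightarrow> ('a \<times> 'a \<times> 'a) set \<Rightarrow> 'a \<Rightarrow> 'a \<Rightarrow> 'a set" where
  "circular_interval X R a b = {x \<in> X. (a, x, b) \<in> R} \<union> {a, b}"

definition circular_base :: "'a set \<Rightarrow> ('a \<times> 'a \<times> 'a) set \<Rightarrow> 'a set set" where
  "circular_base X R = {X - circular_interval X R a b |a b. a \<in> X \<and> b \<in> X} \<union> {X}"

definition COTS :: "'a topology \<Rightarrow> bool" where
  "COTS Y \<longleftrightarrow> (\<exists>R. circular_order_on (topspace Y) R \<and>
     openin Y = arbitrary union_of (\<lambda>U. U \<in> circular_base (topspace Y) R))"

text \<open>The library's linear orders are reflexive, so the strict order is \<open>r - Id\<close>.\<close>

definition open_rays :: "'a set \<Rightarrow> ('a \<times> 'a) set \<Rightarrow> 'a set set" where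
  "open_rays X r = {{x \<in> X. (x, a) \<in> r - Id} |a. a \<in> X} \<union> {{x \<in> X. (a, x) \<in> r - Id} |a. a \<in> X}"

text \<open>The whole space is added to the subbase because \<^const>\<open>topology_generated_by\<close> takes the
  union of the subbase as the underlying set, and the open rays of a one-point order are empty.\<close>

definition LOTS :: "'a topology \<Rightarrow> bool" where
  "LOTS Y \<longleftrightarrow> (\<exists>r. linear_order_on (topspace Y) r \<and>
     Y = topology_generated_by (insert (topspace Y) (open_rays (topspace Y) r)))"

definition embeds_in :: "'a topology \<Rightarrow> 'b topology \<Rightarrow> bool" where
  "embeds_in X Y \<longleftrightarrow> (\<exists>S \<subseteq> topspace Y. X homeomorphic_space subtopology Y S)"

text \<open>The type argument is the type from which the points of the ambient ordered space are taken.
  A theorem assuming \<open>GCOTS TYPE('b) X\<close> for a type variable \<open>'b\<close> covers ambient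
  spaces over every type.\<close>

definition GCOTS :: "'b itself \<Rightarrow> 'a topology \<Rightarrow> bool" where
  "GCOTS _ X \<longleftrightarrow> (\<exists>Y :: 'b topology. COTS Y \<and> embeds_in X Y)"

definition GLOTS :: "'b itself \<Rightarrow> 'a topology \<Rightarrow> bool" where
  "GLOTS _ X \<longleftrightarrow> (\<exists>Y :: 'b topology. LOTS Y \<and> embeds_in X Y)"


section \<open>Banach spaces on linear subspaces\<close>

text \<open>Pointwise scalar multiplication, completing the pointwise addition of
  \<^theory>\<open>HOL-Library.Function_Algebras\<close> to a real vector space.\<close>

instantiation "fun" :: (type, real_vector) real_vector
begin

definition "c *\<^sub>R f = (\<lambda>x. c *\<^sub>R f x)"

instance
  by standard (simp_all add: scaleR_fun_def fun_eq_iff scaleR_add_right scaleR_add_left)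

end

text \<open>A normed space is given by a linear subspace \<open>V\<close> of a real vector space type together with a
  norm \<open>N\<close> whose values outside \<open>V\<close> are irrelevant.\<close>

definition normed_space_on :: "'v::real_vector set \<Rightarrow> ('v \<Rightarrow> real) \<Rightarrow> bool" where
  "normed_space_on V N \<longleftrightarrow> subspace V \<and>
     (\<forall>x\<in>V. 0 \<le> N x) \<and> (\<forall>x\<in>V. N x = 0 \<longleftrightarrow> x = 0) \<and>
     (\<forall>c. \<forall>x\<in>V. N (c *\<^sub>R x) = \<bar>c\<bar> * N x) \<and>
     (\<forall>x\<in>V. \<forall>y\<in>V. N (x + y) \<le> N x + N y)"

text \<open>The value \<open>0\<close> off \<open>V\<close> is there because \<^locale>\<open>Metric_space\<close> demands nonnegativity and
  symmetry of the distance on the whole type.\<close>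

definition norm_dist :: "'v::real_vector set \<Rightarrow> ('v \<Rightarrow> real) \<Rightarrow> 'v \<Rightarrow> 'v \<Rightarrow> real" where
  "norm_dist V N x y = (if x \<in> V \<and> y \<in> V then N (x - y) else 0)"

lemma Metric_space_norm_dist:
  assumes "normed_space_on V N"
  shows "Metric_space V (norm_dist V N)"
proof
  have scale: "N (c *\<^sub>R x) = \<bar>c\<bar> * N x" if "x \<in> V" for c x
    using assms that by (simp add: normed_space_on_def)
  have triangle: "N (x + y) \<le> N x + N y" if "x \<in> V" "y \<in> V" for x y
    using assms that by (simp add: normed_space_on_def)
  have diff: "x - y \<in> V" if "x \<in> V" "y \<in> V" for x y
    using assms that by (simp add: normed_space_on_def subspace_diff)
  fix x y z
  show "0 \<le> norm_dist V N x y"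
    using assms diff by (simp add: norm_dist_def normed_space_on_def)
  have "N (x - y) = N (y - x)" if "x \<in> V" "y \<in> V"
    using scale[OF diff[OF that(2,1)], of "-1"] by simp
  then show "norm_dist V N x y = norm_dist V N y x"
    by (simp add: norm_dist_def)
  show "norm_dist V N x y = 0 \<longleftrightarrow> x = y" if "x \<in> V" "y \<in> V"
    using assms diff that by (simp add: norm_dist_def normed_space_on_def)
  show "norm_dist V N x z \<le> norm_dist V N x y + norm_dist V N y z"
    if "x \<in> V" "y \<in> V" "z \<in> V"
    using triangle[OF diff[OF that(1,2)] diff[OF that(2,3)]] that by (simp add: norm_dist_def)
qed

definition banach_space_on :: "'v::real_vector set \<Rightarrow> ('v \<Rightarrow> real) \<Rightarrow> bool" where
  "banach_space_on V N \<longleftrightarrow>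
     normed_space_on V N \<and> Metric_space.mcomplete V (norm_dist V N)"

definition linear_map_on :: "'v::real_vector set \<Rightarrow> ('v \<Rightarrow> 'w::real_vector) \<Rightarrow> bool" where
  "linear_map_on V T \<longleftrightarrow>
     (\<forall>x\<in>V. \<forall>y\<in>V. T (x + y) = T x + T y) \<and> (\<forall>c. \<forall>x\<in>V. T (c *\<^sub>R x) = c *\<^sub>R T x)"

text \<open>\<open>T\<close> is a linear isomorphism, bounded with bounded inverse, of \<open>(V, N)\<close> onto a subspace
  of \<open>(W, M)\<close>.\<close>

definition isomorphic_embedding_on ::
    "'v::real_vector set \<Rightarrow> ('v \<Rightarrow> real) \<Rightarrow> 'w::real_vector set \<Rightarrow> ('w \<Rightarrow> real) \<Rightarrow> ('v \<Rightarrow> 'w) \<Rightarrow> bool"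
  where
  "isomorphic_embedding_on V N W M T \<longleftrightarrow>
     T \<in> V \<rightarrow> W \<and> linear_map_on V T \<and>
     (\<exists>c C. 0 < c \<and> (\<forall>x\<in>V. c * N x \<le> M (T x) \<and> M (T x) \<le> C * N x))"

definition ell1 :: "(nat \<Rightarrow> real) set" where
  "ell1 = {a. summable (\<lambda>n. \<bar>a n\<bar>)}"

definition ell1_norm :: "(nat \<Rightarrow> real) \<Rightarrow> real" where
  "ell1_norm a = (\<Sum>n. \<bar>a n\<bar>)"

definition rosenthal_banach_space :: "'v::real_vector set \<Rightarrow> ('v \<Rightarrow> real) \<Rightarrow> bool" where
  "rosenthal_banach_space V N \<longleftrightarrow>
     banach_space_on V N \<and> \<not> (\<exists>T. isomorphic_embedding_on ell1 ell1_norm V N T)"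


section \<open>The dual unit ball with the weak-star topology\<close>

text \<open>Functionals on \<open>V\<close> are made extensional, so that each one is represented by exactly one
  HOL function.\<close>

definition dual_space :: "'v::real_vector set \<Rightarrow> ('v \<Rightarrow> real) \<Rightarrow> ('v \<Rightarrow> real) set" where
  "dual_space V N =
     {\<phi> \<in> extensional V. linear_map_on V \<phi> \<and> (\<exists>C. \<forall>v\<in>V. \<bar>\<phi> v\<bar> \<le> C * N v)}"

definition dual_norm :: "'v::real_vector set \<Rightarrow> ('v \<Rightarrow> real) \<Rightarrow> ('v \<Rightarrow> real) \<Rightarrow> real" where
  "dual_norm V N \<phi> = (SUP v\<in>{v \<in> V. N v \<le> 1}. \<bar>\<phi> v\<bar>)"

definition dual_unit_ball :: "'v::real_vector set \<Rightarrow> ('v \<Rightarrow> real) \<Rightarrow> ('v \<Rightarrow> real) set" where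
  "dual_unit_ball V N = {\<phi> \<in> dual_space V N. dual_norm V N \<phi> \<le> 1}"

text \<open>The product topology on the extensional functions on \<open>V\<close> is the topology of pointwise
  convergence on \<open>V\<close>.\<close>

definition weak_star_topology :: "'v::real_vector set \<Rightarrow> ('v \<Rightarrow> real) \<Rightarrow> ('v \<Rightarrow> real) topology" where
  "weak_star_topology V N = subtopology (product_topology (\<lambda>_. euclideanreal) V) (dual_space V N)"


section \<open>Weakly Radon--Nikodym spaces\<close>

text \<open>HOL cannot quantify existentially over types, so \<open>V\<close> ranges over the Banach spaces whose
  vectors are real functions on the type of points of \<open>X\<close>, with an arbitrary complete norm.
  This is no restriction. Let \<open>\<iota>\<close> embed \<open>X\<close> into the dual unit ball of any Rosenthal space \<open>W\<close>
  and let \<open>K\<close> be the closed subspace of those \<open>w\<close> with \<open>\<iota> x w = 0\<close> for all \<open>x\<close>. The quotient of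
  \<open>W\<close> by \<open>K\<close> is again Rosenthal, since a copy of \<open>\<ell>\<^sub>1\<close> in a quotient lifts;
  every \<open>\<iota> x\<close> factors through it, so \<open>X\<close> still embeds in its dual ball; and it is identified with
  a space of functions on \<open>X\<close> by sending the class of \<open>w\<close> to \<open>x \<mapsto> \<iota> x w\<close>.\<close>

definition WRN :: "'a topology \<Rightarrow> bool" where
  "WRN X \<longleftrightarrow> (\<exists>(V :: ('a \<Rightarrow> real) set) N. rosenthal_banach_space V N \<and>
     embeds_in X (subtopology (weak_star_topology V N) (dual_unit_ball V N)))"

end

theory Submission
  imports Defs
begin

text \<open>Every point of \<open>X\<close> is sent to its evaluation functional on a space \<open>V\<close> of functions on \<open>X\<close>:
  the closure, in the norm of 2-variation along a linear order of \<open>X\<close>, of the continuous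
  functions of bounded variation. A circular order is cut at a point to get the linear order; the
  choice of the point does not affect which functions have bounded variation. Monotone Urysohn
  functions provide enough elements of \<open>V\<close> for the evaluation map to be an embedding.

  That \<open>V\<close> contains no \<open>\<ell>\<^sub>1\<close> is seen in two steps. First, \<open>n\<close> functions of 2-variation at most \<open>C\<close>
  are simultaneously \<open>\<epsilon>\<close>-close to their values on a set of \<open>O(n)\<close> points, so suitable signs make
  their signed average uniformly small when \<open>n\<close> is large. Secondly, if \<open>f\<close> is in \<open>V\<close> and \<open>g\<close> is
  uniformly small depending on \<open>f\<close>, then the increments of \<open>f\<close> and \<open>g\<close> are almost orthogonal.
  Hence inside a copy of \<open>\<ell>\<^sub>1\<close> one can add \<open>k\<close> disjoint signed averages with a sum of norm
  \<open>O(sqrt k)\<close>, whereas its \<open>\<ell>\<^sub>1\<close>-norm is \<open>k\<close>.\<close>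

section \<open>The 2-variation norm\<close>

text \<open>The norm has to avoid two extremes. On an interval the supremum norm admits copies of
  \<open>ell1\<close>, since C[0,1] contains every separable Banach space; so does total variation,
  under which the absolutely continuous functions are a copy of L1 plus the constants. Squared
  increments sit between them: almost orthogonal functions then add up as in a Hilbert space, and it
  is this growth like a square root that an \<open>ell1\<close> basis cannot have. The sign argument
  works because the number of points in the net grows only linearly with the number of functions,
  while the chance that random signs give a large sum at one given point decays exponentially. The
  topology enters only through the continuity of the members of \<open>V\<close> and through the
  supply of separating functions, so passing to a subspace amounts to composing with the
  embedding.\<close>

definition ascending :: "'a set \<Rightarrow> ('a \<times> 'a) set \<Rightarrow> 'a list set" where
  "ascending S L = {xs. set xs \<subseteq> S \<and> sorted_wrt (\<lambda>a b. (a, b) \<in> L) xs}"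

text \<open>The increments of \<open>f\<close> include the initial value of \<open>f\<close>, so that the variations below
  dominate the supremum norm and vanish on no constant but \<open>0\<close>.\<close>

definition incr :: "('a \<Rightarrow> real) \<Rightarrow> 'a list \<Rightarrow> nat \<Rightarrow> real" where
  "incr f xs i = f (xs ! i) - (case i of 0 \<Rightarrow> 0 | Suc j \<Rightarrow> f (xs ! j))"

definition var1 :: "('a \<Rightarrow> real) \<Rightarrow> 'a list \<Rightarrow> real" where
  "var1 f xs = (\<Sum>i<length xs. \<bar>incr f xs i\<bar>)"

definition var2 :: "('a \<Rightarrow> real) \<Rightarrow> 'a list \<Rightarrow> real" where
  "var2 f xs = L2_set (incr f xs) {..<length xs}"

definition bv_on :: "'a set \<Rightarrow> ('a \<times> 'a) set \<Rightarrow> ('a \<Rightarrow> real) \<Rightarrow> bool" where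
  "bv_on S L f \<longleftrightarrow> bdd_above (var1 f ` ascending S L)"

definition bv2_on :: "'a set \<Rightarrow> ('a \<times> 'a) set \<Rightarrow> ('a \<Rightarrow> real) \<Rightarrow> bool" where
  "bv2_on S L f \<longleftrightarrow> bdd_above (var2 f ` ascending S L)"

definition norm2_on :: "'a set \<Rightarrow> ('a \<times> 'a) set \<Rightarrow> ('a \<Rightarrow> real) \<Rightarrow> real" where
  "norm2_on S L f = (SUP xs\<in>ascending S L. var2 f xs)"

section \<open>Algebra of increments and variations\<close>

lemma scaleR_fun_apply [simp]: "(c *\<^sub>R f) x = c *\<^sub>R f x"
  by (simp add: scaleR_fun_def)

lemma incr_add: "incr (f + g) xs i = incr f xs i + incr g xs i"
  by (cases i) (auto simp: incr_def)

lemma incr_diff: "incr (f - g) xs i = incr f xs i - incr g xs i"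
  by (cases i) (auto simp: incr_def)

lemma incr_scaleR: "incr (c *\<^sub>R f) xs i = c * incr f xs i"
  by (cases i) (auto simp: incr_def algebra_simps)

lemma incr_cong:
  assumes "\<And>x. x \<in> set xs \<Longrightarrow> f x = g x" "i < length xs"
  shows "incr f xs i = incr g xs i"
  using assms by (cases i) (auto simp: incr_def)

lemma var1_cong: "(\<And>x. x \<in> set xs \<Longrightarrow> f x = g x) \<Longrightarrow> var1 f xs = var1 g xs"
  unfolding var1_def by (intro sum.cong arg_cong[where f = abs] incr_cong) auto

lemma incr_map: "i < length xs \<Longrightarrow> incr f (map \<phi> xs) i = incr (f \<circ> \<phi>) xs i"
  by (cases i) (auto simp: incr_def)

lemma var1_map: "var1 f (map \<phi> xs) = var1 (f \<circ> \<phi>) xs"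
  unfolding var1_def by (intro sum.cong) (auto simp: incr_map)

lemma abs_incr_le:
  assumes "\<And>x. x \<in> set xs \<Longrightarrow> \<bar>f x\<bar> \<le> B" "i < length xs"
  shows "\<bar>incr f xs i\<bar> \<le> 2 * B"
proof (cases i)
  case 0
  have "\<bar>f (xs ! 0)\<bar> \<le> B"
    using assms 0 by auto
  then show ?thesis
    using 0 by (simp add: incr_def)
next
  case (Suc j)
  have "\<bar>f (xs ! i)\<bar> \<le> B" "\<bar>f (xs ! j)\<bar> \<le> B"
    using assms Suc by auto
  then show ?thesis
    using Suc by (simp add: incr_def)
qed

lemma var1_add: "var1 (f + g) xs \<le> var1 f xs + var1 g xs"
  unfolding var1_def incr_add by (simp add: sum.distrib[symmetric] sum_mono)

lemma var1_scaleR: "var1 (c *\<^sub>R f) xs = \<bar>c\<bar> * var1 f xs"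
  unfolding var1_def incr_scaleR by (simp add: sum_distrib_left abs_mult)

lemma var2_add: "var2 (f + g) xs \<le> var2 f xs + var2 g xs"
  unfolding var2_def incr_add by (rule L2_set_triangle_ineq)

lemma var2_scaleR: "var2 (c *\<^sub>R f) xs = \<bar>c\<bar> * var2 f xs"
proof -
  have "(\<Sum>i<length xs. (c * incr f xs i)\<^sup>2) = c\<^sup>2 * (\<Sum>i<length xs. (incr f xs i)\<^sup>2)"
    by (simp add: power_mult_distrib sum_distrib_left)
  then show ?thesis
    unfolding var2_def incr_scaleR L2_set_def by (simp add: real_sqrt_mult)
qed

lemma var2_nonneg: "0 \<le> var2 f xs"
  by (simp add: var2_def)

lemma var2_power2: "(var2 f xs)\<^sup>2 = (\<Sum>i<length xs. (incr f xs i)\<^sup>2)"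
  unfolding var2_def L2_set_def by (simp add: sum_nonneg)

lemma var2_le_var1: "var2 f xs \<le> var1 f xs"
  unfolding var2_def var1_def by (rule L2_set_le_sum_abs)

lemma Nil_in_ascending: "[] \<in> ascending S L"
  by (simp add: ascending_def)

lemma bv2_onI: "(\<And>xs. xs \<in> ascending S L \<Longrightarrow> var2 f xs \<le> K) \<Longrightarrow> bv2_on S L f"
  unfolding bv2_on_def by (rule bdd_aboveI2)

lemma bv_onI: "(\<And>xs. xs \<in> ascending S L \<Longrightarrow> var1 f xs \<le> K) \<Longrightarrow> bv_on S L f"
  unfolding bv_on_def by (rule bdd_aboveI2)

lemma bv_onE:
  assumes "bv_on S L f"
  obtains K where "0 \<le> K" "\<And>xs. xs \<in> ascending S L \<Longrightarrow> var1 f xs \<le> K"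
proof -
  obtain K where "\<And>xs. xs \<in> ascending S L \<Longrightarrow> var1 f xs \<le> K"
    using assms by (auto simp: bv_on_def bdd_above_def)
  then show thesis
    using that[of "max K 0"] by (simp add: le_max_iff_disj)
qed

lemma var2_le_norm2_on: "bv2_on S L f \<Longrightarrow> xs \<in> ascending S L \<Longrightarrow> var2 f xs \<le> norm2_on S L f"
  by (simp add: norm2_on_def bv2_on_def cSUP_upper)

lemma norm2_on_leI: "(\<And>xs. xs \<in> ascending S L \<Longrightarrow> var2 f xs \<le> K) \<Longrightarrow> norm2_on S L f \<le> K"
  unfolding norm2_on_def using Nil_in_ascending by (intro cSUP_least) auto

lemma norm2_on_nonneg: "bv2_on S L f \<Longrightarrow> 0 \<le> norm2_on S L f"
  by (rule order_trans[OF var2_nonneg var2_le_norm2_on[OF _ Nil_in_ascending]])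

lemma bv_on_imp_bv2_on: "bv_on S L f \<Longrightarrow> bv2_on S L f"
  by (elim bv_onE, rule bv2_onI, rule order_trans[OF var2_le_var1])

lemma bv_on_add: "bv_on S L f \<Longrightarrow> bv_on S L g \<Longrightarrow> bv_on S L (f + g)"
proof (elim bv_onE)
  fix K K' assume "\<And>xs. xs \<in> ascending S L \<Longrightarrow> var1 f xs \<le> K"
    "\<And>xs. xs \<in> ascending S L \<Longrightarrow> var1 g xs \<le> K'"
  then show ?thesis
    by (intro bv_onI[where K = "K + K'"] order_trans[OF var1_add] add_mono)
qed

lemma bv_on_scaleR: "bv_on S L f \<Longrightarrow> bv_on S L (c *\<^sub>R f)"
proof (elim bv_onE)
  fix K assume "\<And>xs. xs \<in> ascending S L \<Longrightarrow> var1 f xs \<le> K"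
  then show ?thesis
    by (intro bv_onI[where K = "\<bar>c\<bar> * K"]) (simp add: var1_scaleR mult_left_mono)
qed

lemma bv_on_cong:
  assumes "bv_on S L f" "\<And>x. x \<in> S \<Longrightarrow> f x = g x"
  shows "bv_on S L g"
proof -
  have "var1 g xs = var1 f xs" if "xs \<in> ascending S L" for xs
    using that assms(2) by (intro var1_cong) (auto simp: ascending_def)
  then have "var1 g ` ascending S L = var1 f ` ascending S L"
    by (rule image_cong[OF refl])
  then show ?thesis
    using assms(1) by (simp add: bv_on_def)
qed

lemma bv_on_diff: "bv_on S L f \<Longrightarrow> bv_on S L g \<Longrightarrow> bv_on S L (f - g)"
  using bv_on_add[of S L f "(-1) *\<^sub>R g"] bv_on_scaleR[of S L g "-1"] by simp

lemma bv2_on_add: "bv2_on S L f \<Longrightarrow> bv2_on S L g \<Longrightarrow> bv2_on S L (f + g)"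
  by (rule bv2_onI, rule order_trans[OF var2_add], rule add_mono) (auto intro: var2_le_norm2_on)

lemma norm2_on_add:
  "bv2_on S L f \<Longrightarrow> bv2_on S L g \<Longrightarrow> norm2_on S L (f + g) \<le> norm2_on S L f + norm2_on S L g"
  by (rule norm2_on_leI, rule order_trans[OF var2_add], rule add_mono) (auto intro: var2_le_norm2_on)

lemma bv2_on_scaleR: "bv2_on S L f \<Longrightarrow> bv2_on S L (c *\<^sub>R f)"
  by (rule bv2_onI) (simp add: var2_scaleR, rule mult_left_mono, erule (1) var2_le_norm2_on, simp)

lemma norm2_on_scaleR:
  assumes "bv2_on S L f"
  shows "norm2_on S L (c *\<^sub>R f) = \<bar>c\<bar> * norm2_on S L f"
proof -
  have le: "norm2_on S L (c *\<^sub>R f) \<le> \<bar>c\<bar> * norm2_on S L f" if "bv2_on S L f" for c f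
    by (rule norm2_on_leI) (simp add: var2_scaleR mult_left_mono var2_le_norm2_on that)
  show ?thesis
  proof (cases "c = 0")
    case True
    with le[OF assms, of c] norm2_on_nonneg[OF bv2_on_scaleR[OF assms, of c]] show ?thesis
      by simp
  next
    case False
    have "norm2_on S L (inverse c *\<^sub>R c *\<^sub>R f) \<le> \<bar>inverse c\<bar> * norm2_on S L (c *\<^sub>R f)"
      by (rule le) (rule bv2_on_scaleR[OF assms])
    with False have "\<bar>c\<bar> * norm2_on S L f \<le> norm2_on S L (c *\<^sub>R f)"
      by (simp add: field_simps)
    with le[OF assms, of c] show ?thesis
      by simp
  qed
qed

lemma bv2_on_diff: "bv2_on S L f \<Longrightarrow> bv2_on S L g \<Longrightarrow> bv2_on S L (f - g)"
  using bv2_on_add[of S L f "(-1) *\<^sub>R g"] bv2_on_scaleR[of S L g "-1"] by simp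

lemma abs_le_norm2_on:
  assumes "bv2_on S L f" "x \<in> S"
  shows "\<bar>f x\<bar> \<le> norm2_on S L f"
proof -
  have "var2 f [x] \<le> norm2_on S L f"
    using assms by (intro var2_le_norm2_on) (auto simp: ascending_def)
  then show ?thesis
    by (simp add: var2_def incr_def lessThan_Suc)
qed

text \<open>This is the source of all functions of bounded variation below: the increments after the
  first are nonnegative and telescope.\<close>

lemma bv_on_monotone:
  assumes mono: "\<And>x y. x \<in> S \<Longrightarrow> y \<in> S \<Longrightarrow> (x, y) \<in> L \<Longrightarrow> f x \<le> f y"
    and bound: "\<And>x. x \<in> S \<Longrightarrow> \<bar>f x\<bar> \<le> B"
  shows "bv_on S L f"
proof (rule bv_onI)
  fix xs assume xs: "xs \<in> ascending S L"
  have in_S: "xs ! i \<in> S" if "i < length xs" for i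
    using xs that by (auto simp: ascending_def)
  have step: "f (xs ! i) \<le> f (xs ! Suc i)" if "Suc i < length xs" for i
    using xs that in_S by (intro mono) (auto simp: ascending_def sorted_wrt_iff_nth_less)
  have telescope: "(\<Sum>i<Suc n. \<bar>incr f xs i\<bar>) = \<bar>f (xs ! 0)\<bar> + f (xs ! n) - f (xs ! 0)"
    if "n < length xs" for n
    using that
  proof (induction n)
    case 0
    then show ?case
      by (simp add: incr_def)
  next
    case (Suc n)
    then show ?case
      using step[of n] by (simp add: incr_def)
  qed
  \<comment> \<open>Initial value plus total rise is at most three times the bound. The absolute
    value covers an empty \<open>S\<close>, where \<open>B\<close> may be negative.\<close>
  show "var1 f xs \<le> 3 * \<bar>B\<bar>"
  proof (cases xs)
    case Nil
    then show ?thesis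
      by (simp add: var1_def)
  next
    case (Cons y ys)
    then show ?thesis
      using telescope[of "length ys"] bound[OF in_S[of 0]] bound[OF in_S[of "length ys"]]
      by (simp add: var1_def)
  qed
qed

section \<open>The Banach space\<close>

locale ordered_topology =
  fixes X :: "'a topology" and L :: "('a \<times> 'a) set"
  assumes linear: "linear_order_on (topspace X) L"
begin

abbreviation asc :: "'a list set" where
  "asc \<equiv> ascending (topspace X) L"

abbreviation bv2 :: "('a \<Rightarrow> real) \<Rightarrow> bool" where
  "bv2 \<equiv> bv2_on (topspace X) L"

abbreviation N :: "('a \<Rightarrow> real) \<Rightarrow> real" where
  "N \<equiv> norm2_on (topspace X) L"

text \<open>\<open>N\<close> sees only the values on \<open>topspace X\<close>. Prescribing 0
  elsewhere makes it a norm and not merely a seminorm on functions of the whole type.\<close>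

definition BVC :: "('a \<Rightarrow> real) set" where
  "BVC = {h. (\<forall>x. x \<notin> topspace X \<longrightarrow> h x = 0) \<and> continuous_map X euclideanreal h \<and>
     bv_on (topspace X) L h}"

text \<open>The closure of \<open>BVC\<close>. Taking all continuous functions of bounded 2-variation instead would
  not do: on an interval they contain a copy of \<open>\<ell>\<^sub>\<infinity>\<close>.\<close>

definition V :: "('a \<Rightarrow> real) set" where
  "V = {f. (\<forall>x. x \<notin> topspace X \<longrightarrow> f x = 0) \<and> bv2 f \<and> (\<forall>e>0. \<exists>h\<in>BVC. N (f - h) \<le> e)}"

section \<open>Linear structure and norm of \<open>V\<close>\<close>

lemma BVC_add: "h \<in> BVC \<Longrightarrow> k \<in> BVC \<Longrightarrow> h + k \<in> BVC"
proof -
  have "h + k = (\<lambda>x. h x + k x)"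
    by (simp add: fun_eq_iff)
  moreover assume "h \<in> BVC" "k \<in> BVC"
  ultimately show ?thesis
    using continuous_map_add[of X h k] bv_on_add[of "topspace X" L h k] by (simp add: BVC_def)
qed

lemma BVC_scaleR: "h \<in> BVC \<Longrightarrow> c *\<^sub>R h \<in> BVC"
proof -
  have "c *\<^sub>R h = (\<lambda>x. c * h x)"
    by (simp add: scaleR_fun_def)
  moreover assume "h \<in> BVC"
  ultimately show ?thesis
    using continuous_map_real_mult_left[of X h c] bv_on_scaleR[of "topspace X" L h c]
    by (simp add: BVC_def)
qed

lemma BVC_bv2: "h \<in> BVC \<Longrightarrow> bv2 h"
  by (simp add: BVC_def bv_on_imp_bv2_on)

lemma zero_BVC: "0 \<in> BVC"
proof -
  have "var1 0 xs = 0" for xs :: "'a list"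
    unfolding var1_def by (rule sum.neutral) (simp add: incr_def split: nat.split)
  then have "bv_on (topspace X) L 0"
    by (intro bv_onI[where K = 0]) simp
  moreover have "continuous_map X euclideanreal 0"
    by (simp add: zero_fun_def)
  ultimately show ?thesis
    by (simp add: BVC_def)
qed

lemma N_zero: "N 0 = 0"
  using norm2_on_scaleR[OF BVC_bv2[OF zero_BVC], of 0] by simp

lemma BVC_subset_V: "BVC \<subseteq> V"
proof (intro subsetI)
  fix f assume f: "f \<in> BVC"
  then have "\<exists>h\<in>BVC. N (f - h) \<le> e" if "e > 0" for e
    using N_zero that by (intro bexI[of _ f]) auto
  with f show "f \<in> V"
    by (simp add: V_def BVC_bv2) (simp add: BVC_def)
qed

lemma V_bv2: "f \<in> V \<Longrightarrow> bv2 f"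
  by (simp add: V_def)

lemma V_off: "f \<in> V \<Longrightarrow> x \<notin> topspace X \<Longrightarrow> f x = 0"
  by (simp add: V_def)

lemma V_approx:
  assumes "f \<in> V" "e > 0"
  obtains h where "h \<in> BVC" "N (f - h) \<le> e"
  using assms by (auto simp: V_def)

lemma subspace_V: "subspace V"
proof (rule subspaceI)
  show "0 \<in> V"
    using BVC_subset_V zero_BVC by blast
next
  fix f g assume fg: "f \<in> V" "g \<in> V"
  have "\<exists>h\<in>BVC. N (f + g - h) \<le> e" if e: "e > 0" for e
  proof -
    obtain h where h: "h \<in> BVC" "N (f - h) \<le> e / 2"
      using V_approx[OF fg(1) half_gt_zero[OF e]] .
    obtain k where k: "k \<in> BVC" "N (g - k) \<le> e / 2"
      using V_approx[OF fg(2) half_gt_zero[OF e]] .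
    have "N ((f - h) + (g - k)) \<le> N (f - h) + N (g - k)"
      by (intro norm2_on_add bv2_on_diff V_bv2 BVC_bv2 fg h k)
    also have "\<dots> \<le> e"
      using h k by simp
    finally show ?thesis
      using BVC_add[OF h(1) k(1)] by (intro bexI[of _ "h + k"]) (simp_all add: algebra_simps)
  qed
  then show "f + g \<in> V"
    using fg by (auto simp: V_def bv2_on_add)
next
  fix c f assume f: "f \<in> V"
  have "\<exists>h\<in>BVC. N (c *\<^sub>R f - h) \<le> e" if e: "e > 0" for e
  proof -
    obtain h where h: "h \<in> BVC" "N (f - h) \<le> e / (\<bar>c\<bar> + 1)"
      using V_approx[OF f, of "e / (\<bar>c\<bar> + 1)"] e by (metis abs_add_one_gt_zero add.commute divide_pos_pos)
    have "N (c *\<^sub>R f - c *\<^sub>R h) = \<bar>c\<bar> * N (f - h)"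
      unfolding scaleR_diff_right[symmetric]
      by (intro norm2_on_scaleR bv2_on_diff V_bv2 BVC_bv2 f h)
    also have "\<dots> \<le> (\<bar>c\<bar> + 1) * N (f - h)"
      by (intro mult_right_mono norm2_on_nonneg bv2_on_diff V_bv2 BVC_bv2 f h) simp
    also have "\<dots> \<le> e"
      using h by (simp add: field_simps)
    finally show ?thesis
      using BVC_scaleR[OF h(1)] by blast
  qed
  then show "c *\<^sub>R f \<in> V"
    using f by (simp add: V_def bv2_on_scaleR)
qed

lemma abs_le_N: "f \<in> V \<Longrightarrow> x \<in> topspace X \<Longrightarrow> \<bar>f x\<bar> \<le> N f"
  by (simp add: abs_le_norm2_on V_bv2)

lemma normed_space_V: "normed_space_on V N"
  unfolding normed_space_on_def
proof (intro conjI ballI allI subspace_V)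
  fix f g and c :: real assume f: "f \<in> V" and g: "g \<in> V"
  show "0 \<le> N f"
    by (rule norm2_on_nonneg[OF V_bv2[OF f]])
  show "N f = 0 \<longleftrightarrow> f = 0"
  proof
    assume "N f = 0"
    then have "f x = 0" for x
      using abs_le_N[OF f] V_off[OF f] by (cases "x \<in> topspace X") auto
    then show "f = 0"
      by (simp add: fun_eq_iff)
  qed (simp add: N_zero)
  show "N (c *\<^sub>R f) = \<bar>c\<bar> * N f"
    by (rule norm2_on_scaleR[OF V_bv2[OF f]])
  show "N (f + g) \<le> N f + N g"
    by (intro norm2_on_add V_bv2 f g)
qed

text \<open>Since \<open>N\<close> dominates the supremum, closeness in \<open>N\<close> to
  continuous functions is uniform closeness. Continuity on \<open>X\<close> is what makes the
  evaluation map weak-star continuous.\<close>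

lemma continuous_V:
  assumes "f \<in> V"
  shows "continuous_map X euclideanreal f"
proof -
  have "\<exists>h\<in>BVC. N (f - h) \<le> inverse (Suc n)" for n
    by (rule V_approx[OF assms, of "inverse (Suc n)"]) auto
  then obtain h where h: "\<And>n. h n \<in> BVC" "\<And>n. N (f - h n) \<le> inverse (Suc n)"
    by metis
  have near: "dist (h n x) (f x) \<le> inverse (Suc n)" if "x \<in> topspace X" for n x
  proof -
    have "\<bar>(f - h n) x\<bar> \<le> N (f - h n)"
      using that by (intro abs_le_norm2_on bv2_on_diff V_bv2 BVC_bv2 assms h)
    with h(2)[of n] show ?thesis
      by (simp add: dist_real_def)
  qed
  have "continuous_map X Met_TC.mtopology f"
  proof (rule Met_TC.continuous_map_uniform_limit_alt[where F = sequentially and f = h])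
    show "\<forall>\<^sub>F n in sequentially. continuous_map X Met_TC.mtopology (h n)"
      using h(1) by (simp add: BVC_def)
    show "\<forall>\<^sub>F n in sequentially. \<forall>x\<in>topspace X. dist (h n x) (f x) < e" if e: "0 < e" for e :: real
    proof -
      have "\<forall>\<^sub>F n in sequentially. inverse (real (Suc n)) < e"
        using e order_tendstoD(2)[OF LIMSEQ_inverse_real_of_nat] by blast
      then show ?thesis
        by (rule eventually_mono) (use near order_le_less_trans in blast)
    qed
  qed auto
  then show ?thesis
    by simp
qed

section \<open>Completeness\<close>

lemma norm_dist_V: "f \<in> V \<Longrightarrow> g \<in> V \<Longrightarrow> norm_dist V N f g = N (f - g)"
  by (simp add: norm_dist_def)

lemma mcomplete_V: "Metric_space.mcomplete V (norm_dist V N)"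
proof -
  interpret Metric_space V "norm_dist V N"
    by (rule Metric_space_norm_dist[OF normed_space_V])
  show ?thesis
    unfolding mcomplete_def
  proof (intro allI impI)
    fix \<sigma> assume "MCauchy \<sigma>"
    then have \<sigma>: "\<sigma> n \<in> V"
      and "0 < e \<Longrightarrow> \<exists>M. \<forall>m n. M \<le> m \<longrightarrow> M \<le> n \<longrightarrow> norm_dist V N (\<sigma> m) (\<sigma> n) < e" for n e
      unfolding MCauchy_def by blast+
    then have cauchy: "\<exists>M. \<forall>m\<ge>M. \<forall>n\<ge>M. N (\<sigma> m - \<sigma> n) < e" if "0 < e" for e
      using that by (simp add: norm_dist_V[OF \<sigma> \<sigma>])
    have diff: "\<sigma> m - \<sigma> n \<in> V" for m n
      by (rule subspace_diff[OF subspace_V \<sigma> \<sigma>])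
    have "Cauchy (\<lambda>n. \<sigma> n x)" for x
    proof (rule metric_CauchyI)
      fix e :: real assume "0 < e"
      then obtain M where M: "\<forall>m\<ge>M. \<forall>n\<ge>M. N (\<sigma> m - \<sigma> n) < e"
        using cauchy by blast
      have "dist (\<sigma> m x) (\<sigma> n x) < e" if "m \<ge> M" "n \<ge> M" for m n
      proof (cases "x \<in> topspace X")
        case True
        then show ?thesis
          using order_le_less_trans[OF abs_le_N[OF diff[of m n]]] M that
          by (simp add: dist_real_def)
      next
        case False
        then show ?thesis
          using \<open>0 < e\<close> by (simp add: V_off[OF \<sigma>])
      qed
      then show "\<exists>M. \<forall>m\<ge>M. \<forall>n\<ge>M. dist (\<sigma> m x) (\<sigma> n x) < e"
        by blast
    qed
    then have "\<exists>l. (\<lambda>n. \<sigma> n x) \<longlonglongrightarrow> l" for x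
      by (simp add: real_Cauchy_convergent convergent_def[symmetric])
    then obtain f where f: "\<And>x. (\<lambda>n. \<sigma> n x) \<longlonglongrightarrow> f x"
      by metis
    \<comment> \<open>A fixed list involves finitely many values, so its Cauchy bound survives the
      pointwise limit. Only then is the supremum over all lists taken.\<close>
    have var2_le: "var2 (\<sigma> m - f) xs \<le> e"
      if M: "\<forall>m\<ge>M. \<forall>n\<ge>M. N (\<sigma> m - \<sigma> n) < e" and m: "m \<ge> M" and xs: "xs \<in> asc" for m M e xs
    proof (rule tendsto_upperbound)
      have "(\<lambda>n. incr (\<sigma> m - \<sigma> n) xs i) \<longlonglongrightarrow> incr (\<sigma> m - f) xs i" for i
        unfolding incr_def by (cases i) (auto intro!: tendsto_intros f)
      then show "(\<lambda>n. var2 (\<sigma> m - \<sigma> n) xs) \<longlonglongrightarrow> var2 (\<sigma> m - f) xs"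
        unfolding var2_def L2_set_def by (intro tendsto_intros)
      show "\<forall>\<^sub>F n in sequentially. var2 (\<sigma> m - \<sigma> n) xs \<le> e"
        using eventually_ge_at_top[of M]
      proof eventually_elim
        case (elim n)
        then show ?case
          using order_trans[OF var2_le_norm2_on[OF V_bv2[OF diff] xs] less_imp_le] M m by blast
      qed
    qed simp
    obtain M where M: "\<forall>m\<ge>M. \<forall>n\<ge>M. N (\<sigma> m - \<sigma> n) < 1"
      using cauchy[of 1] by auto
    have "bv2 (\<sigma> M - f)"
      by (rule bv2_onI, rule var2_le[OF M order_refl])
    from bv2_on_diff[OF V_bv2[OF \<sigma>[of M]] this] have bv2_f: "bv2 f"
      by simp
    have N_le: "N (\<sigma> m - f) \<le> e"
      if "\<forall>m\<ge>M. \<forall>n\<ge>M. N (\<sigma> m - \<sigma> n) < e" and "m \<ge> M" for m M e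
      by (rule norm2_on_leI, rule var2_le[OF that])
    have N_commute: "N (f - g) = N (g - f)" if "bv2 g" for g
      using norm2_on_scaleR[OF bv2_on_diff[OF that bv2_f], of "-1"] by simp
    have "\<exists>h\<in>BVC. N (f - h) \<le> e" if "0 < e" for e
    proof -
      obtain M where M: "\<forall>m\<ge>M. \<forall>n\<ge>M. N (\<sigma> m - \<sigma> n) < e / 2"
        using cauchy[OF half_gt_zero[OF \<open>0 < e\<close>]] by blast
      obtain h where h: "h \<in> BVC" "N (\<sigma> M - h) \<le> e / 2"
        using V_approx[OF \<sigma> half_gt_zero[OF \<open>0 < e\<close>]] .
      have "N ((f - \<sigma> M) + (\<sigma> M - h)) \<le> N (f - \<sigma> M) + N (\<sigma> M - h)"
        by (intro norm2_on_add bv2_on_diff bv2_f V_bv2 \<sigma> BVC_bv2 h)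
      also have "\<dots> \<le> e"
        using N_le[OF M, of M] N_commute[OF V_bv2[OF \<sigma>], of M] h by simp
      finally show ?thesis
        using h(1) by (intro bexI[of _ h]) simp_all
    qed
    moreover have "f x = 0" if "x \<notin> topspace X" for x
      using f[of x] by (simp add: V_off[OF \<sigma> that] LIMSEQ_const_iff)
    ultimately have fV: "f \<in> V"
      using bv2_f by (simp add: V_def)
    have "limitin mtopology \<sigma> f sequentially"
      unfolding limit_metric_sequentially
    proof (intro conjI fV allI impI)
      fix e :: real assume "0 < e"
      then obtain M where M: "\<forall>m\<ge>M. \<forall>n\<ge>M. N (\<sigma> m - \<sigma> n) < e / 2"
        using cauchy[of "e / 2"] by auto
      have "norm_dist V N (\<sigma> n) f < e" if "n \<ge> M" for n
        using N_le[OF M that] \<open>0 < e\<close> by (simp add: norm_dist_V[OF \<sigma> fV])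
      then show "\<exists>M. \<forall>n\<ge>M. \<sigma> n \<in> V \<and> norm_dist V N (\<sigma> n) f < e"
        using \<sigma> by blast
    qed
    then show "\<exists>f. limitin mtopology \<sigma> f sequentially"
      by blast
  qed
qed

lemma banach_V: "banach_space_on V N"
  by (simp add: banach_space_on_def normed_space_V mcomplete_V)

end

section \<open>Absence of \<open>\<ell>\<^sub>1\<close>\<close>

text \<open>Take a longest ascending list in which any two neighbours are separated by more than
  \<open>e\<close> by some \<open>u i\<close>. Every such jump costs \<open>e\<^sup>2\<close> out of
  the total budget \<open>n * C\<^sup>2\<close> of squared 2-variations, which bounds the length. By
  maximality the list is a net: a point far from all its entries could be inserted at its place in
  the order.\<close>

lemma finite_net:
  fixes u :: "nat \<Rightarrow> 'a \<Rightarrow> real" and n :: nat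
  assumes linear: "linear_order_on S L"
    and u: "\<And>i. bv2_on S L (u i)" "\<And>i. norm2_on S L (u i) \<le> C"
    and "0 < e"
  obtains P where "finite P" "P \<subseteq> S" "real (card P) \<le> n * (C\<^sup>2 / e\<^sup>2) + 1"
    "\<And>x. x \<in> S \<Longrightarrow> \<exists>p\<in>P. \<forall>i<n. \<bar>u i x - u i p\<bar> \<le> e"
proof -
  define far where "far x y \<longleftrightarrow> (\<exists>i<n. e < \<bar>u i x - u i y\<bar>)" for x y
  define good where "good xs \<longleftrightarrow> xs \<in> ascending S L \<and> successively far xs" for xs
  have length_le: "real (length xs) \<le> n * (C\<^sup>2 / e\<^sup>2) + 1" if "good xs" for xs
  proof -
    have xs: "xs \<in> ascending S L" and suc: "successively far xs"
      using that by (auto simp: good_def)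
    have "e\<^sup>2 \<le> (\<Sum>i<n. (incr (u i) xs (Suc j))\<^sup>2)" if "Suc j < length xs" for j
    proof -
      have "far (xs ! j) (xs ! Suc j)"
        using suc that by (simp add: successively_conv_nth)
      then obtain i where i: "i < n" "e < \<bar>u i (xs ! j) - u i (xs ! Suc j)\<bar>"
        by (auto simp: far_def)
      have "e\<^sup>2 \<le> \<bar>u i (xs ! j) - u i (xs ! Suc j)\<bar>\<^sup>2"
        using i \<open>0 < e\<close> by (intro power_mono) auto
      also have "\<dots> = (incr (u i) xs (Suc j))\<^sup>2"
        by (simp add: incr_def power2_commute)
      also have "\<dots> \<le> (\<Sum>i<n. (incr (u i) xs (Suc j))\<^sup>2)"
        using i by (intro member_le_sum) auto
      finally show ?thesis .
    qed
    \<comment> \<open>The increment with index 0 is an initial value and not a jump between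
      neighbours. Hence the shift by \<open>Suc\<close> and the final \<open>+ 1\<close> in the
      bound.\<close>
    then have "(\<Sum>j<length xs - 1. e\<^sup>2) \<le> (\<Sum>j<length xs - 1. \<Sum>i<n. (incr (u i) xs (Suc j))\<^sup>2)"
      by (intro sum_mono) auto
    also have "\<dots> = (\<Sum>j\<in>Suc ` {..<length xs - 1}. \<Sum>i<n. (incr (u i) xs j)\<^sup>2)"
      by (subst sum.reindex) auto
    also have "\<dots> \<le> (\<Sum>j<length xs. \<Sum>i<n. (incr (u i) xs j)\<^sup>2)"
      by (intro sum_mono2) (auto intro: sum_nonneg)
    also have "\<dots> = (\<Sum>i<n. (var2 (u i) xs)\<^sup>2)"
      unfolding var2_power2 by (rule sum.swap)
    also have "\<dots> \<le> (\<Sum>i<n. C\<^sup>2)"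
      by (intro sum_mono power_mono var2_nonneg order_trans[OF var2_le_norm2_on[OF u(1) xs] u(2)])
    finally have "real (length xs - 1) \<le> n * (C\<^sup>2 / e\<^sup>2)"
      using \<open>0 < e\<close> by (simp add: field_simps)
    then show ?thesis
      by linarith
  qed
  have "good []"
    by (simp add: good_def Nil_in_ascending)
  moreover have "\<forall>xs. good xs \<longrightarrow> length xs < Suc (nat \<lceil>n * (C\<^sup>2 / e\<^sup>2) + 1\<rceil>)"
  proof (intro allI impI)
    fix xs assume "good xs"
    from length_le[OF this] show "length xs < Suc (nat \<lceil>n * (C\<^sup>2 / e\<^sup>2) + 1\<rceil>)"
      by linarith
  qed
  ultimately have "\<exists>xs. good xs \<and> (\<forall>ys. good ys \<longrightarrow> length ys \<le> length xs)"
    by (rule Lattices_Big.ex_has_greatest_nat)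
  then obtain xs where xs: "good xs" and max: "\<And>ys. good ys \<Longrightarrow> length ys \<le> length xs"
    by blast
  have near: "\<exists>p\<in>set xs. \<forall>i<n. \<bar>u i x - u i p\<bar> \<le> e" if "x \<in> S" for x
  proof (rule ccontr)
    assume "\<not> ?thesis"
    then have far_x: "far p x" "far x p" if "p \<in> set xs" for p
      using that by (auto simp: far_def not_le abs_minus_commute)
    \<comment> \<open>The list is split at the place of \<open>x\<close>. Being far from every
      entry, \<open>x\<close> is far from its two new neighbours.\<close>
    define ys where "ys = takeWhile (\<lambda>y. (y, x) \<in> L) xs"
    define zs where "zs = dropWhile (\<lambda>y. (y, x) \<in> L) xs"
    have xs_eq: "xs = ys @ zs"
      by (simp add: ys_def zs_def)
    have asc: "set xs \<subseteq> S" "sorted_wrt (\<lambda>a b. (a, b) \<in> L) (ys @ zs)"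
      using xs by (auto simp: good_def ascending_def xs_eq)
    have suc: "successively far (ys @ zs)"
      using xs by (simp add: good_def xs_eq)
    have ys_x: "(y, x) \<in> L" if "y \<in> set ys" for y
      using that by (auto simp: ys_def dest: set_takeWhileD)
    have x_zs: "(x, z) \<in> L" if z: "z \<in> set zs" for z
    proof -
      obtain w ws where zs_eq: "zs = w # ws"
        using z by (cases zs) auto
      have "(w, x) \<notin> L"
        using hd_dropWhile[of "\<lambda>y. (y, x) \<in> L" xs] zs_eq
        by (metis list.distinct(1) list.sel(1) zs_def)
      moreover have "w \<in> S"
        using asc xs_eq zs_eq by auto
      ultimately have xw: "(x, w) \<in> L"
        using linear \<open>x \<in> S\<close> unfolding linear_order_on_def partial_order_on_def preorder_on_def
          total_on_def refl_on_def by metis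
      have "(w, z) \<in> L" if "z \<noteq> w"
        using asc(2) z that by (auto simp: zs_eq sorted_wrt_append)
      with xw show ?thesis
        using linear unfolding linear_order_on_def partial_order_on_def preorder_on_def
        by (metis transD)
    qed
    have "ys = [] \<or> far (last ys) x"
      using far_x(1)[of "last ys"] by (cases "ys = []") (simp_all add: xs_eq)
    moreover have "zs = [] \<or> far x (hd zs)"
      using far_x(2)[of "hd zs"] by (cases "zs = []") (simp_all add: xs_eq)
    ultimately have "successively far (ys @ x # zs)"
      using suc by (auto simp: successively_append_iff successively_Cons)
    moreover have "ys @ x # zs \<in> ascending S L"
      using asc ys_x x_zs \<open>x \<in> S\<close> by (auto simp: ascending_def xs_eq sorted_wrt_append)
    ultimately have "good (ys @ x # zs)"
      by (simp add: good_def)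
    from max[OF this] show False
      by (simp add: xs_eq)
  qed
  show thesis
  proof (rule that[of "set xs"])
    show "set xs \<subseteq> S"
      using xs by (auto simp: good_def ascending_def)
    show "real (card (set xs)) \<le> n * (C\<^sup>2 / e\<^sup>2) + 1"
      using length_le[OF xs] card_length[of xs] by linarith
  qed (use near in auto)
qed

text \<open>The signs are chosen one at a time so as not to increase the potential: its average over the
  two choices is multiplied by at most \<open>cosh l\<close>.\<close>

lemma balancing_signs:
  fixes w :: "nat \<Rightarrow> 'a \<Rightarrow> real"
  assumes "finite P" and w: "\<And>i p. p \<in> P \<Longrightarrow> \<bar>w i p\<bar> \<le> 1" and "0 < l"
  shows "\<exists>s. (\<forall>i. \<bar>s i\<bar> = 1) \<and> (\<Sum>p\<in>P. cosh (l * (\<Sum>i<n. s i * w i p))) \<le> card P * cosh l ^ n"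
proof (induction n)
  case 0
  show ?case
    by (rule exI[of _ "\<lambda>_. 1"]) simp
next
  case (Suc n)
  then obtain s where s: "\<And>i. \<bar>s i\<bar> = 1"
    and le: "(\<Sum>p\<in>P. cosh (l * (\<Sum>i<n. s i * w i p))) \<le> card P * cosh l ^ n"
    by blast
  define A where "A p = l * (\<Sum>i<n. s i * w i p)" for p
  have ext: "l * (\<Sum>i<Suc n. (s(n := t)) i * w i p) = A p + t * (l * w n p)" for t p
    by (simp add: A_def algebra_simps)
  have cosh_w: "cosh (l * w n p) \<le> cosh l" if "p \<in> P" for p
  proof -
    have "cosh (l * w n p) = cosh \<bar>l * w n p\<bar>"
      by (simp add: abs_if)
    also have "\<dots> \<le> cosh l"
      using w[OF that, of n] \<open>0 < l\<close>
      by (subst cosh_real_nonneg_le_iff) (auto simp: abs_mult)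
    finally show ?thesis .
  qed
  have "(\<Sum>p\<in>P. cosh (A p + l * w n p)) + (\<Sum>p\<in>P. cosh (A p - l * w n p))
      = (\<Sum>p\<in>P. 2 * (cosh (A p) * cosh (l * w n p)))"
    by (simp add: sum.distrib[symmetric] cosh_add cosh_diff)
  also have "\<dots> \<le> (\<Sum>p\<in>P. 2 * (cosh (A p) * cosh l))"
    by (intro sum_mono mult_left_mono cosh_w) auto
  also have "\<dots> = 2 * ((\<Sum>p\<in>P. cosh (A p)) * cosh l)"
    by (simp add: sum_distrib_left sum_distrib_right)
  also have "\<dots> \<le> 2 * ((card P * cosh l ^ n) * cosh l)"
    using le by (intro mult_left_mono mult_right_mono) (auto simp: A_def)
  finally have "(\<Sum>p\<in>P. cosh (A p + l * w n p)) \<le> card P * cosh l ^ Suc n \<or>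
      (\<Sum>p\<in>P. cosh (A p - l * w n p)) \<le> card P * cosh l ^ Suc n"
    by (simp add: mult.assoc mult.commute[of "cosh l"]) linarith
  then show ?case
  proof
    assume "(\<Sum>p\<in>P. cosh (A p + l * w n p)) \<le> card P * cosh l ^ Suc n"
    then show ?thesis
      using s by (intro exI[of _ "s(n := 1)"]) (simp add: ext del: sum.lessThan_Suc fun_upd_apply, simp)
  next
    assume "(\<Sum>p\<in>P. cosh (A p - l * w n p)) \<le> card P * cosh l ^ Suc n"
    then show ?thesis
      using s by (intro exI[of _ "s(n := -1)"]) (simp add: ext del: sum.lessThan_Suc fun_upd_apply, simp)
  qed
qed

text \<open>Both sides equal 1 at \<open>l = 0\<close>, where \<open>cosh\<close> has slope 0 and
  the exponential has slope \<open>e\<close>.\<close>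

lemma ex_cosh_less_exp:
  assumes "0 < (e::real)"
  shows "\<exists>l>0. cosh l < exp (l * e)"
proof -
  have "((\<lambda>l. cosh l - exp (l * e)) has_real_derivative - e) (at 0)"
    by (auto intro!: derivative_eq_intros)
  from DERIV_neg_dec_right[OF this] assms obtain d where d: "0 < d"
    "\<And>h. 0 < h \<Longrightarrow> h < d \<Longrightarrow> cosh h - exp (h * e) < 0"
    by auto
  from d(1) d(2)[of "d / 2"] show ?thesis
    by (intro exI[of _ "d / 2"]) auto
qed

text \<open>Exponential decay beats the linear size of the net. A sum larger than
  \<open>e / 2 * n\<close> at a single net point would contribute at least half of
  \<open>exp (l * (e / (2 * C))) ^ n\<close> to the potential, but the signs keep the potential
  below \<open>(n * K + 1) * cosh l ^ n\<close>. The other half of \<open>e\<close> pays for moving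
  from the net to arbitrary points.\<close>

lemma small_signed_sum:
  fixes u :: "nat \<Rightarrow> 'a \<Rightarrow> real"
  assumes linear: "linear_order_on S L"
    and u: "\<And>i. bv2_on S L (u i)" "\<And>i. norm2_on S L (u i) \<le> C"
    and "0 < C" "0 < e"
  shows "\<exists>n s. 0 < n \<and> (\<forall>i. \<bar>s i\<bar> = 1) \<and> (\<forall>x\<in>S. \<bar>\<Sum>i<n. s i * u i x\<bar> \<le> e * real n)"
proof -
  obtain l where l: "0 < l" "cosh l < exp (l * (e / (2 * C)))"
    using ex_cosh_less_exp[of "e / (2 * C)"] assms by auto
  define r where "r = cosh l / exp (l * (e / (2 * C)))"
  \<comment> \<open>The cost in net points of each function at precision \<open>e / 2\<close>, as
    given by \<open>finite_net\<close>.\<close>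
  define K where "K = C\<^sup>2 / (e / 2)\<^sup>2"
  have "0 < r" "r < 1"
    using l by (auto simp: r_def)
  then have "norm r < 1"
    by simp
  then have "(\<lambda>n. 2 * (K * (real n * r ^ n) + r ^ n)) \<longlonglongrightarrow> 2 * (K * 0 + 0)"
    by (intro tendsto_intros powser_times_n_limit_0 LIMSEQ_power_zero)
  then have "\<forall>\<^sub>F n in sequentially. 2 * (K * (real n * r ^ n) + r ^ n) < 1"
    by (intro order_tendstoD) auto
  then have "\<forall>\<^sub>F n in sequentially. 0 < n \<and> 2 * (K * (real n * r ^ n) + r ^ n) < 1"
    using eventually_gt_at_top[of 0] by eventually_elim auto
  from eventually_happens'[OF sequentially_bot this]
  obtain n where n: "0 < n" "2 * (K * (real n * r ^ n) + r ^ n) < 1"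
    by blast
  obtain P where P: "finite P" "P \<subseteq> S" "real (card P) \<le> n * K + 1"
    and net: "\<And>x. x \<in> S \<Longrightarrow> \<exists>p\<in>P. \<forall>i<n. \<bar>u i x - u i p\<bar> \<le> e / 2"
    by (rule finite_net[where u = u and n = n, OF linear u half_gt_zero[OF \<open>0 < e\<close>], folded K_def])
      (rule that)
  define w where "w i p = u i p / C" for i p
  have "\<bar>w i p\<bar> \<le> 1" if "p \<in> P" for i p
  proof -
    have "\<bar>u i p\<bar> \<le> C"
      using that P by (intro order_trans[OF abs_le_norm2_on[OF u(1)] u(2)]) auto
    then show ?thesis
      using \<open>0 < C\<close> by (simp add: w_def)
  qed
  from balancing_signs[where w = w and n = n, OF P(1) this l(1)]
  obtain s where s: "\<And>i. \<bar>s i\<bar> = 1"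
    and pot: "(\<Sum>p\<in>P. cosh (l * (\<Sum>i<n. s i * w i p))) \<le> card P * cosh l ^ n"
    by blast
  have on_net: "\<bar>\<Sum>i<n. s i * u i p\<bar> \<le> e / 2 * n" if "p \<in> P" for p
  proof (rule ccontr)
    assume less: "\<not> ?thesis"
    define A where "A = (\<Sum>i<n. s i * w i p)"
    have "A = (\<Sum>i<n. s i * u i p) / C"
      by (simp add: A_def w_def sum_divide_distrib)
    then have "\<bar>A\<bar> = \<bar>\<Sum>i<n. s i * u i p\<bar> / C"
      using \<open>0 < C\<close> by simp
    with less have "e / (2 * C) * n < \<bar>A\<bar>"
      using \<open>0 < C\<close> by (simp add: field_simps)
    then have "l * (e / (2 * C) * n) < l * \<bar>A\<bar>"
      by (rule mult_strict_left_mono[OF _ l(1)])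
    then have "exp (l * (e / (2 * C))) ^ n < exp \<bar>l * A\<bar>"
      using l(1) by (simp add: exp_of_nat_mult[symmetric] abs_mult mult_ac)
    also have "\<dots> \<le> 2 * cosh \<bar>l * A\<bar>"
      by (simp add: cosh_field_def)
    also have "\<dots> = 2 * cosh (l * A)"
      by (simp add: abs_if)
    also have "\<dots> \<le> 2 * (\<Sum>p\<in>P. cosh (l * (\<Sum>i<n. s i * w i p)))"
      unfolding A_def using that P(1)
      by (intro mult_left_mono member_le_sum) auto
    also have "\<dots> \<le> 2 * (card P * cosh l ^ n)"
      using pot by simp
    also have "\<dots> \<le> 2 * ((n * K + 1) * cosh l ^ n)"
      using P(3) by (intro mult_left_mono mult_right_mono) auto
    finally have "1 < 2 * ((n * K + 1) * r ^ n)"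
      by (simp add: r_def power_divide field_simps)
    with n(2) show False
      by (simp add: algebra_simps)
  qed
  have "\<bar>\<Sum>i<n. s i * u i x\<bar> \<le> e * n" if x: "x \<in> S" for x
  proof -
    obtain p where p: "p \<in> P" "\<forall>i<n. \<bar>u i x - u i p\<bar> \<le> e / 2"
      using net[OF x] by blast
    have "\<bar>\<Sum>i<n. s i * (u i x - u i p)\<bar> \<le> (\<Sum>i<n. \<bar>s i * (u i x - u i p)\<bar>)"
      by (rule sum_abs)
    also have "\<dots> \<le> (\<Sum>i<n. e / 2)"
      using p by (intro sum_mono) (auto simp: abs_mult s)
    finally have "\<bar>(\<Sum>i<n. s i * u i x) - (\<Sum>i<n. s i * u i p)\<bar> \<le> e / 2 * n"
      by (simp add: right_diff_distrib sum_subtractf mult.commute)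
    with on_net[OF p(1)] show ?thesis
      by linarith
  qed
  with n(1) s show ?thesis
    by blast
qed

section \<open>Linear maps and finitely supported sequences\<close>

lemma linear_map_on_sum:
  assumes "subspace W" "linear_map_on W T" "\<And>i. i \<in> I \<Longrightarrow> x i \<in> W"
  shows "T (\<Sum>i\<in>I. c i *\<^sub>R x i) = (\<Sum>i\<in>I. c i *\<^sub>R T (x i))"
proof -
  have T0: "T 0 = 0"
    using assms(2) subspace_0[OF assms(1)] unfolding linear_map_on_def
    by (metis scaleR_zero_left)
  show ?thesis
    using assms(3)
  proof (induction I rule: infinite_finite_induct)
    case (insert i I)
    have "(\<Sum>i\<in>I. c i *\<^sub>R x i) \<in> W" "c i *\<^sub>R x i \<in> W" "x i \<in> W"
      using insert.prems assms(1) by (auto intro!: subspace_sum subspace_scale)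
    with insert assms(2) show ?case
      by (simp add: linear_map_on_def)
  qed (simp_all add: T0)
qed

lemma subspace_ell1: "subspace ell1"
proof (rule subspaceI)
  fix a b assume "a \<in> ell1" "b \<in> ell1"
  then have "summable (\<lambda>n. \<bar>a n\<bar> + \<bar>b n\<bar>)"
    by (simp add: ell1_def summable_add)
  then show "a + b \<in> ell1"
    unfolding ell1_def mem_Collect_eq by (rule summable_comparison_test[rotated]) (auto intro: abs_triangle_ineq)
qed (auto simp: ell1_def abs_mult)

lemma finite_support_ell1:
  assumes "\<And>j. m \<le> j \<Longrightarrow> a j = 0"
  shows "a \<in> ell1" "ell1_norm a = (\<Sum>j<m. \<bar>a j\<bar>)"
  using assms summable_finite[of "{..<m}" "\<lambda>n. \<bar>a n\<bar>"] suminf_finite[of "{..<m}" "\<lambda>n. \<bar>a n\<bar>"]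
  by (auto simp: ell1_def ell1_norm_def not_less)

section \<open>Almost orthogonality and the contradiction with \<open>ell1\<close>\<close>

context ordered_topology
begin

text \<open>Almost orthogonality: in the increments of \<open>f + g\<close> the mixed terms are bounded by the
  product of the variation of \<open>f\<close> and the supremum of \<open>g\<close>, up to replacing \<open>f\<close> by a nearby
  function of bounded variation.\<close>

lemma almost_orthogonal:
  assumes f: "f \<in> V" and "0 < C"
  shows "\<exists>d>0. \<forall>g\<in>V. N g \<le> C \<longrightarrow> (\<forall>x\<in>topspace X. \<bar>g x\<bar> \<le> d) \<longrightarrow>
    (N (f + g))\<^sup>2 \<le> (N f)\<^sup>2 + C\<^sup>2 + 1"
proof -
  \<comment> \<open>The mixed term is split along \<open>f = h + (f - h)\<close> into two sums. Each
    will be at most 1/4 and occurs with factor 2, which adds up to the 1 of the claim. For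
    \<open>f - h\<close> this is Cauchy-Schwarz: \<open>1 / (4 * C)\<close> times
    \<open>C\<close>.\<close>
  have "0 < 1 / (4 * C)"
    using \<open>0 < C\<close> by simp
  then obtain h where h: "h \<in> BVC" "N (f - h) \<le> 1 / (4 * C)"
    by (rule V_approx[OF f])
  then have "bv_on (topspace X) L h"
    by (simp add: BVC_def)
  then obtain K where K: "0 \<le> K" "\<And>xs. xs \<in> asc \<Longrightarrow> var1 h xs \<le> K"
    by (rule bv_onE) (rule that)
  \<comment> \<open>Increments of \<open>g\<close> are at most \<open>2 * d\<close>, so the sum with
    \<open>h\<close> is at most \<open>2 * d * K \<le> 1 / 4\<close>. Adding 1 to \<open>K\<close>
    avoids dividing by zero.\<close>
  define d where "d = 1 / (8 * (K + 1))"
  have d: "0 < d" "d * K \<le> 1 / 8"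
    using K(1) by (auto simp: d_def field_simps)
  have "(N (f + g))\<^sup>2 \<le> (N f)\<^sup>2 + C\<^sup>2 + 1"
    if g: "g \<in> V" "N g \<le> C" and small: "\<And>x. x \<in> topspace X \<Longrightarrow> \<bar>g x\<bar> \<le> d" for g
  proof -
    have var2_le: "var2 (f + g) xs \<le> sqrt ((N f)\<^sup>2 + C\<^sup>2 + 1)" if xs: "xs \<in> asc" for xs
    proof -
      let ?I = "{..<length xs}"
      have "(\<Sum>i\<in>?I. incr h xs i * incr g xs i) \<le> (\<Sum>i\<in>?I. \<bar>incr h xs i\<bar> * (2 * d))"
      proof (rule sum_mono)
        fix i assume "i \<in> ?I"
        then have "\<bar>incr g xs i\<bar> \<le> 2 * d"
          using small xs by (intro abs_incr_le) (auto simp: ascending_def)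
        then have "\<bar>incr h xs i * incr g xs i\<bar> \<le> \<bar>incr h xs i\<bar> * (2 * d)"
          unfolding abs_mult by (intro mult_left_mono) auto
        then show "incr h xs i * incr g xs i \<le> \<bar>incr h xs i\<bar> * (2 * d)"
          by linarith
      qed
      also have "\<dots> = var1 h xs * (2 * d)"
        by (simp add: var1_def sum_distrib_right)
      also have "\<dots> \<le> K * (2 * d)"
        using K(2)[OF xs] d(1) by (intro mult_right_mono) auto
      also have "\<dots> \<le> 1 / 4"
        using d(2) by (simp add: mult.commute)
      finally have 1: "(\<Sum>i\<in>?I. incr h xs i * incr g xs i) \<le> 1 / 4" .
      have "(\<Sum>i\<in>?I. incr (f - h) xs i * incr g xs i)
          \<le> (\<Sum>i\<in>?I. \<bar>incr (f - h) xs i\<bar> * \<bar>incr g xs i\<bar>)"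
        by (intro sum_mono) (metis abs_ge_self abs_mult)
      also have "\<dots> \<le> var2 (f - h) xs * var2 g xs"
        unfolding var2_def by (rule L2_set_mult_ineq)
      also have "\<dots> \<le> (1 / (4 * C)) * C"
      proof (intro mult_mono var2_nonneg)
        show "var2 (f - h) xs \<le> 1 / (4 * C)"
          using var2_le_norm2_on[OF bv2_on_diff[OF V_bv2[OF f] BVC_bv2[OF h(1)]] xs] h(2) by simp
        show "var2 g xs \<le> C"
          using var2_le_norm2_on[OF V_bv2[OF g(1)] xs] g(2) by simp
      qed (use \<open>0 < C\<close> in simp)
      also have "\<dots> = 1 / 4"
        using \<open>0 < C\<close> by simp
      finally have 2: "(\<Sum>i\<in>?I. incr (f - h) xs i * incr g xs i) \<le> 1 / 4" .
      have "(var2 (f + g) xs)\<^sup>2 = (\<Sum>i\<in>?I. (incr f xs i)\<^sup>2 + (incr g xs i)\<^sup>2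
          + 2 * (incr h xs i * incr g xs i) + 2 * (incr (f - h) xs i * incr g xs i))"
        unfolding var2_power2 incr_add incr_diff
        by (intro sum.cong) (simp_all add: power2_eq_square algebra_simps)
      also have "\<dots> = (var2 f xs)\<^sup>2 + (var2 g xs)\<^sup>2
          + 2 * (\<Sum>i\<in>?I. incr h xs i * incr g xs i) + 2 * (\<Sum>i\<in>?I. incr (f - h) xs i * incr g xs i)"
        unfolding var2_power2 by (simp add: sum.distrib sum_distrib_left)
      also have "\<dots> \<le> (N f)\<^sup>2 + C\<^sup>2 + 1"
      proof -
        have "(var2 f xs)\<^sup>2 \<le> (N f)\<^sup>2"
          by (intro power_mono var2_nonneg var2_le_norm2_on V_bv2 f xs)
        moreover have "(var2 g xs)\<^sup>2 \<le> C\<^sup>2"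
          by (intro power_mono var2_nonneg order_trans[OF var2_le_norm2_on g(2)] V_bv2 g(1) xs)
        ultimately show ?thesis
          using 1 2 by linarith
      qed
      finally show ?thesis
        by (rule real_le_rsqrt)
    qed
    have "N (f + g) \<le> sqrt ((N f)\<^sup>2 + C\<^sup>2 + 1)"
      by (rule norm2_on_leI, rule var2_le)
    then have "(N (f + g))\<^sup>2 \<le> (sqrt ((N f)\<^sup>2 + C\<^sup>2 + 1))\<^sup>2"
      by (intro power_mono norm2_on_nonneg bv2_on_add V_bv2 f g(1))
    then show ?thesis
      by (simp add: add_nonneg_nonneg)
  qed
  with d(1) show ?thesis
    by blast
qed

text \<open>Keeping the vectors finitely supported lets each new block be placed beyond the old
  support, so that the \<open>ell1\<close> norms add exactly.\<close>

lemma no_ell1: "\<not> isomorphic_embedding_on ell1 ell1_norm V N T"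
proof
  assume emb: "isomorphic_embedding_on ell1 ell1_norm V N T"
  then obtain c C where c: "0 < c"
    and bounds: "\<And>a. a \<in> ell1 \<Longrightarrow> c * ell1_norm a \<le> N (T a) \<and> N (T a) \<le> C * ell1_norm a"
    unfolding isomorphic_embedding_on_def by blast
  have TV: "T a \<in> V" if "a \<in> ell1" for a
    using emb that by (auto simp: isomorphic_embedding_on_def)
  have lin: "linear_map_on ell1 T"
    using emb by (simp add: isomorphic_embedding_on_def)
  define unit :: "nat \<Rightarrow> nat \<Rightarrow> real" where "unit i = (\<lambda>j. if j = i then 1 else 0)" for i
  have unit: "unit i \<in> ell1" "ell1_norm (unit i) = 1" for i
    using finite_support_ell1[of "Suc i" "unit i"] by (auto simp: unit_def)
  \<comment> \<open>The definition gives \<open>C\<close> no sign, but the image of a unit vector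
    has norm between \<open>c\<close> and \<open>C\<close>.\<close>
  have "0 < C"
    using bounds[OF unit(1)[of 0]] unit(2)[of 0] c by simp
  have step: "\<exists>m' a'. (\<forall>j\<ge>m'. a' j = 0) \<and> ell1_norm a' = ell1_norm a + 1 \<and>
      (N (T a'))\<^sup>2 \<le> (N (T a))\<^sup>2 + C\<^sup>2 + 1" if a: "\<forall>j\<ge>m. a j = 0" for m a
  proof -
    have a_ell1: "a \<in> ell1" "ell1_norm a = (\<Sum>j<m. \<bar>a j\<bar>)"
      using finite_support_ell1[of m a] a by auto
    \<comment> \<open>The order of choices matters: \<open>d\<close> depends on \<open>T a\<close>
      only, and the new block is made uniformly smaller than this \<open>d\<close>
      afterwards.\<close>
    obtain d where d: "0 < d" and orth: "\<And>g. g \<in> V \<Longrightarrow> N g \<le> C \<Longrightarrow>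
        (\<forall>x\<in>topspace X. \<bar>g x\<bar> \<le> d) \<Longrightarrow> (N (T a + g))\<^sup>2 \<le> (N (T a))\<^sup>2 + C\<^sup>2 + 1"
      using almost_orthogonal[OF TV[OF a_ell1(1)] \<open>0 < C\<close>] by blast
    have u: "bv2 (T (unit (m + i)))" "N (T (unit (m + i))) \<le> C" for i
      using bounds[OF unit(1)[of "m + i"]] unit(2)[of "m + i"] by (auto intro: V_bv2 TV unit(1))
    obtain n s where n: "0 < n" and s: "\<And>i. \<bar>s i\<bar> = 1"
      and small: "\<And>x. x \<in> topspace X \<Longrightarrow> \<bar>\<Sum>i<n. s i * T (unit (m + i)) x\<bar> \<le> d * real n"
      using small_signed_sum[where u = "\<lambda>i. T (unit (m + i))", OF linear u \<open>0 < C\<close> d] by blast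
    \<comment> \<open>Dividing by \<open>n\<close> gives \<open>ell1\<close> norm 1. Hence
      \<open>T b\<close> has norm at most \<open>C\<close>, although its supremum is at most
      \<open>d\<close>.\<close>
    define b where "b = (\<Sum>i<n. (s i / n) *\<^sub>R unit (m + i))"
    have b_ell1: "b \<in> ell1"
      unfolding b_def by (intro subspace_sum subspace_scale subspace_ell1 unit)
    have sum_apply: "(\<Sum>i<k. F i) x = (\<Sum>i<k. F i x)" for F :: "nat \<Rightarrow> 'd \<Rightarrow> real" and k x
      by (induction k) auto
    have b_apply: "b j = (if m \<le> j \<and> j < m + n then s (j - m) / n else 0)" for j
    proof -
      have "b j = (\<Sum>i<n. if i = j - m \<and> m \<le> j then s i / n else 0)"
        unfolding b_def sum_apply by (intro sum.cong) (auto simp: unit_def)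
      then show ?thesis
        by (cases "m \<le> j") (auto simp: less_diff_conv2)
    qed
    have abs_sum: "(\<Sum>j<n. \<bar>b (m + j)\<bar>) = 1"
      using n by (simp add: b_apply s)
    have Tb: "T b = (\<Sum>i<n. (s i / n) *\<^sub>R T (unit (m + i)))"
      unfolding b_def by (rule linear_map_on_sum[OF subspace_ell1 lin unit(1)])
    have "\<bar>T b x\<bar> \<le> d" if "x \<in> topspace X" for x
    proof -
      have "T b x = (\<Sum>i<n. s i * T (unit (m + i)) x) / n"
        unfolding Tb sum_apply by (simp add: sum_divide_distrib)
      then have "\<bar>T b x\<bar> = \<bar>\<Sum>i<n. s i * T (unit (m + i)) x\<bar> / n"
        by simp
      also have "\<dots> \<le> d"
        using small[OF that] n by (simp add: pos_divide_le_eq)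
      finally show ?thesis .
    qed
    moreover have "N (T b) \<le> C"
    proof -
      have "ell1_norm b = (\<Sum>j<m + n. \<bar>b j\<bar>)"
        by (rule finite_support_ell1) (simp add: b_apply)
      also have "\<dots> = (\<Sum>j<m. \<bar>b j\<bar>) + (\<Sum>j<n. \<bar>b (m + j)\<bar>)"
        by (induction n) auto
      also have "\<dots> = 1"
        by (simp add: abs_sum) (simp add: b_apply)
      finally show ?thesis
        using bounds[OF b_ell1] by simp
    qed
    ultimately have "(N (T a + T b))\<^sup>2 \<le> (N (T a))\<^sup>2 + C\<^sup>2 + 1"
      using orth TV[OF b_ell1] by blast
    moreover have "T (a + b) = T a + T b"
      using lin a_ell1 b_ell1 by (simp add: linear_map_on_def)
    moreover have "ell1_norm (a + b) = ell1_norm a + 1"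
    proof -
      have "ell1_norm (a + b) = (\<Sum>j<m + n. \<bar>(a + b) j\<bar>)"
        by (rule finite_support_ell1) (use a in \<open>simp add: b_apply\<close>)
      also have "\<dots> = (\<Sum>j<m. \<bar>(a + b) j\<bar>) + (\<Sum>j<n. \<bar>(a + b) (m + j)\<bar>)"
        by (induction n) auto
      also have "(\<Sum>j<m. \<bar>(a + b) j\<bar>) = ell1_norm a"
        by (simp add: a_ell1 b_apply)
      also have "(\<Sum>j<n. \<bar>(a + b) (m + j)\<bar>) = (\<Sum>j<n. \<bar>b (m + j)\<bar>)"
        using a by simp
      finally show ?thesis
        by (simp only: abs_sum)
    qed
    moreover have "\<forall>j\<ge>m + n. (a + b) j = 0"
      using a by (simp add: b_apply)
    ultimately show ?thesis
      by metis
  qed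
  have "\<exists>m a. (\<forall>j\<ge>m. a j = 0) \<and> ell1_norm a = real k \<and> (N (T a))\<^sup>2 \<le> k * (C\<^sup>2 + 1)" for k :: nat
  proof (induction k)
    case 0
    have zero: "(0::nat \<Rightarrow> real) \<in> ell1" "ell1_norm 0 = 0"
      using finite_support_ell1[of 0 0] by auto
    then have "N (T 0) = 0"
      using bounds[OF zero(1)] norm2_on_nonneg[OF V_bv2[OF TV[OF zero(1)]]] by simp
    then have "(N (T 0))\<^sup>2 \<le> real 0 * (C\<^sup>2 + 1)"
      by (simp only: of_nat_0 mult_zero_left zero_power2)
    moreover have "\<forall>j\<ge>0. (0::nat \<Rightarrow> real) j = 0" "ell1_norm 0 = real 0"
      using zero(2) by (simp_all only: zero_fun_apply of_nat_0 simp_thms)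
    ultimately show ?case
      by blast
  next
    case (Suc k)
    then obtain m a where a: "\<forall>j\<ge>m. a j = 0" "ell1_norm a = real k" "(N (T a))\<^sup>2 \<le> k * (C\<^sup>2 + 1)"
      by blast
    from step[OF a(1)] obtain m' a' where "\<forall>j\<ge>m'. a' j = 0" "ell1_norm a' = ell1_norm a + 1"
      "(N (T a'))\<^sup>2 \<le> (N (T a))\<^sup>2 + C\<^sup>2 + 1"
      by blast
    with a show ?case
      by (intro exI[of _ m'] exI[of _ a']) (simp add: algebra_simps)
  qed
  note growth = this
  \<comment> \<open>For such \<open>k\<close> the lower bound \<open>c * k\<close> exceeds the upper
    bound \<open>sqrt (k * (C\<^sup>2 + 1))\<close>.\<close>
  obtain k :: nat where k: "(C\<^sup>2 + 1) / c\<^sup>2 < real k"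
    using reals_Archimedean2 by blast
  then have "0 < real k"
    using c by (smt (verit) divide_nonneg_pos zero_le_power2 zero_less_power)
  obtain m a where a: "\<forall>j\<ge>m. a j = 0" "ell1_norm a = real k" "(N (T a))\<^sup>2 \<le> k * (C\<^sup>2 + 1)"
    using growth[of k] by blast
  have "a \<in> ell1"
    using finite_support_ell1(1)[of m a] a(1) by blast
  with bounds a(2) have "c * real k \<le> N (T a)"
    by fastforce
  then have "(c * real k)\<^sup>2 \<le> (N (T a))\<^sup>2"
    using c by (intro power_mono) auto
  with a(3) have "real k * (c\<^sup>2 * real k) \<le> real k * (C\<^sup>2 + 1)"
    by (simp add: power2_eq_square mult_ac)
  with \<open>0 < real k\<close> have "c\<^sup>2 * real k \<le> C\<^sup>2 + 1"
    by (simp only: mult_le_cancel_left_pos)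
  with k c show False
    by (simp add: field_simps)
qed

lemma rosenthal_V: "rosenthal_banach_space V N"
  by (simp add: rosenthal_banach_space_def banach_V no_ell1)

end

section \<open>Embedding into the dual ball\<close>

context ordered_topology
begin

lemma evaluation_in_dual_unit_ball:
  assumes x: "x \<in> topspace X"
  shows "restrict (\<lambda>v. v x) V \<in> dual_unit_ball V N"
proof -
  have le: "\<bar>v x\<bar> \<le> N v" if "v \<in> V" for v
    by (rule abs_le_N[OF that x])
  have "linear_map_on V (restrict (\<lambda>v. v x) V)"
    by (simp add: linear_map_on_def subspace_add subspace_scale subspace_V)
  moreover have "\<exists>C. \<forall>v\<in>V. \<bar>restrict (\<lambda>v. v x) V v\<bar> \<le> C * N v"
    using le by (intro exI[of _ 1]) simp
  moreover have "dual_norm V N (restrict (\<lambda>v. v x) V) \<le> 1"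
    unfolding dual_norm_def
  proof (rule cSUP_least)
    show "{v \<in> V. N v \<le> 1} \<noteq> {}"
      using subspace_0[OF subspace_V] N_zero by auto
  qed (use le in fastforce)
  ultimately show ?thesis
    by (simp add: dual_unit_ball_def dual_space_def)
qed

lemma WRN_if_bv_separated:
  assumes sep: "\<And>U x. openin X U \<Longrightarrow> x \<in> U \<Longrightarrow> \<exists>f. continuous_map X euclideanreal f \<and>
      bv_on (topspace X) L f \<and> f x = 1 \<and> (\<forall>y\<in>topspace X - U. f y = 0)"
    and "t0_space X"
  shows "WRN X"
proof -
  define Z where "Z = subtopology (weak_star_topology V N) (dual_unit_ball V N)"
  have topspace_Z: "topspace Z = dual_unit_ball V N"
    by (auto simp: Z_def weak_star_topology_def dual_unit_ball_def dual_space_def PiE_def)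
  define ev where "ev x = restrict (\<lambda>v. v x) V" for x
  have ev_Z: "ev x \<in> topspace Z" if "x \<in> topspace X" for x
    unfolding ev_def topspace_Z by (rule evaluation_in_dual_unit_ball[OF that])
  have sepV: "\<exists>f\<in>V. f x = 1 \<and> (\<forall>y\<in>topspace X - U. f y = 0)" if U: "openin X U" "x \<in> U" for U x
  proof -
    obtain f where f: "continuous_map X euclideanreal f" "bv_on (topspace X) L f" "f x = 1"
      "\<forall>y\<in>topspace X - U. f y = 0"
      using sep[OF U] by blast
    \<comment> \<open>Membership in \<open>V\<close> demands the value 0 off
      \<open>topspace X\<close>, where \<open>f\<close> is arbitrary.\<close>
    define h where "h y = (if y \<in> topspace X then f y else 0)" for y
    have "continuous_map X euclideanreal h"
      by (rule continuous_map_eq[OF f(1)]) (simp add: h_def)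
    moreover have "bv_on (topspace X) L h"
      by (rule bv_on_cong[OF f(2)]) (simp add: h_def)
    ultimately have "h \<in> BVC"
      by (simp add: BVC_def h_def)
    moreover have "x \<in> topspace X"
      using U openin_subset by blast
    ultimately show ?thesis
      using f(3,4) BVC_subset_V by (intro bexI[of _ h]) (auto simp: h_def)
  qed
  have continuous_Z: "continuous_map Z euclideanreal (\<lambda>\<phi>. \<phi> v)" if "v \<in> V" for v
    unfolding Z_def weak_star_topology_def
    by (intro continuous_map_from_subtopology continuous_map_product_projection that)
  have "embedding_map X Z ev"
    unfolding embedding_map_def
  proof (rule bijective_open_imp_homeomorphic_map)
    have "continuous_map X (product_topology (\<lambda>_. euclideanreal) V) ev"
      unfolding continuous_map_componentwise by (auto simp: ev_def continuous_V)
    moreover have "ev ` topspace X \<subseteq> dual_unit_ball V N"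
      using ev_Z topspace_Z by auto
    moreover have "dual_unit_ball V N \<subseteq> dual_space V N"
      by (auto simp: dual_unit_ball_def)
    ultimately show "continuous_map X (subtopology Z (ev ` topspace X)) ev"
      unfolding Z_def weak_star_topology_def by (auto simp: continuous_map_in_subtopology)
    show "open_map X (subtopology Z (ev ` topspace X)) ev"
      unfolding open_map_def
    proof (intro allI impI)
      fix U assume U: "openin X U"
      let ?Z = "subtopology Z (ev ` topspace X)"
      have "\<exists>T. openin ?Z T \<and> ev x \<in> T \<and> T \<subseteq> ev ` U" if "x \<in> U" for x
      proof -
        obtain f where f: "f \<in> V" "f x = 1" "\<forall>y\<in>topspace X - U. f y = 0"
          using sepV[OF U \<open>x \<in> U\<close>] by blast
        have "continuous_map ?Z euclideanreal (\<lambda>\<phi>. \<phi> f)"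
          by (intro continuous_map_from_subtopology continuous_Z f(1))
        then have "openin ?Z {\<phi> \<in> topspace ?Z. 0 < \<phi> f}"
          unfolding continuous_map_upper_lower_semicontinuous_lt by blast
        moreover have "x \<in> topspace X"
          using U \<open>x \<in> U\<close> openin_subset by blast
        then have "ev x \<in> {\<phi> \<in> topspace ?Z. 0 < \<phi> f}"
          using ev_Z f by (simp add: ev_def[of x]) (auto simp: ev_def)
        moreover have "{\<phi> \<in> topspace ?Z. 0 < \<phi> f} \<subseteq> ev ` U"
        proof clarsimp
          fix y assume "y \<in> topspace X" "0 < ev y f"
          with f show "ev y \<in> ev ` U"
            by (cases "y \<in> U") (auto simp: ev_def)
        qed
        ultimately show ?thesis
          by blast
      qed
      then show "openin ?Z (ev ` U)"
        by (subst openin_subopen) blast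
    qed
    show "ev ` topspace X = topspace (subtopology Z (ev ` topspace X))"
      using ev_Z by auto
    show "inj_on ev (topspace X)"
    proof (rule inj_onI, rule ccontr)
      fix x y assume xy: "x \<in> topspace X" "y \<in> topspace X" "ev x = ev y" "x \<noteq> y"
      have eq: "f x = f y" if "f \<in> V" for f
        using fun_cong[OF xy(3), of f] that by (simp add: ev_def)
      obtain U where "openin X U" "x \<notin> U \<longleftrightarrow> y \<in> U"
        using \<open>t0_space X\<close> xy unfolding t0_space_def by blast
      then obtain f where f: "f \<in> V" "f x = 1 \<and> f y = 0 \<or> f y = 1 \<and> f x = 0"
        using sepV[of U x] sepV[of U y] xy by blast
      then show False
        using eq[OF f(1)] by auto
    qed
  qed
  then have "X homeomorphic_space subtopology Z (ev ` topspace X)"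
    by (rule embedding_map_imp_homeomorphic_space)
  then have "embeds_in X Z"
    using ev_Z unfolding embeds_in_def by (intro exI[of _ "ev ` topspace X"]) auto
  with rosenthal_V show ?thesis
    unfolding WRN_def Z_def by blast
qed

end

text \<open>A hereditary property, so it suffices to check it on the ambient LOTS or COTS. The order
  only measures variation and is not tied to the topology, since the topology of a COTS need not be
  that of a cut order.\<close>

definition bv_separated :: "'a topology \<Rightarrow> ('a \<times> 'a) set \<Rightarrow> bool" where
  "bv_separated Y L \<longleftrightarrow> linear_order_on (topspace Y) L \<and> t0_space Y \<and>
     (\<forall>U x. openin Y U \<and> x \<in> U \<longrightarrow> (\<exists>f. continuous_map Y euclideanreal f \<and>
       bv_on (topspace Y) L f \<and> f x = 1 \<and> (\<forall>y\<in>topspace Y - U. f y = 0)))"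

text \<open>Order and separating functions are pulled back along the embedding. It carries ascending
  lists to ascending lists, so the variation of a pulled back function cannot grow.\<close>

lemma WRN_if_embeds_in_bv_separated:
  assumes Y: "bv_separated Y L" and "embeds_in X Y"
  shows "WRN X"
proof -
  obtain A where A: "A \<subseteq> topspace Y" "X homeomorphic_space subtopology Y A"
    using assms(2) by (auto simp: embeds_in_def)
  then obtain \<phi> where \<phi>: "homeomorphic_map X (subtopology Y A) \<phi>"
    using homeomorphic_space by blast
  then have inj: "inj_on \<phi> (topspace X)" and "\<phi> ` topspace X = A"
    using A(1) by (auto simp: homeomorphic_eq_everything_map topspace_subtopology_subset)
  then have \<phi>_Y: "\<phi> x \<in> topspace Y" if "x \<in> topspace X" for x
    using A(1) that by auto
  have cont: "continuous_map X Y \<phi>"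
    using homeomorphic_imp_continuous_map[OF \<phi>] by (simp add: continuous_map_in_subtopology)
  define K where "K = {(x, y). x \<in> topspace X \<and> y \<in> topspace X \<and> (\<phi> x, \<phi> y) \<in> L}"
  have L: "linear_order_on (topspace Y) L"
    using Y by (simp add: bv_separated_def)
  have "linear_order_on (topspace X) K"
    unfolding linear_order_on_def partial_order_on_def preorder_on_def
  proof (intro conjI)
    show "K \<subseteq> topspace X \<times> topspace X"
      by (auto simp: K_def)
    show "refl_on (topspace X) K"
      using L \<phi>_Y by (auto simp: K_def order_on_defs refl_on_def)
    show "trans K"
      using L by (auto simp: K_def order_on_defs intro!: transI dest: transD)
    show "antisym K"
      using L inj by (auto simp: K_def order_on_defs intro!: antisymI dest: antisymD inj_onD)
    show "total_on (topspace X) K"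
      using L inj \<phi>_Y by (auto simp: K_def order_on_defs total_on_def inj_on_eq_iff)
  qed
  then interpret ordered_topology X K
    by unfold_locales
  show ?thesis
  proof (rule WRN_if_bv_separated)
    have "t0_space (subtopology Y A)"
      using Y by (simp add: bv_separated_def t0_space_subtopology)
    then show "t0_space X"
      using A(2) homeomorphic_t0_space by blast
  next
    fix U x assume U: "openin X U" and x: "x \<in> U"
    have "openin (subtopology Y A) (\<phi> ` U)"
      using \<phi> U openin_subset[OF U] by (simp add: homeomorphic_map_openness)
    then obtain W where W: "openin Y W" "\<phi> ` U = W \<inter> A"
      by (auto simp: openin_subtopology)
    then have "\<phi> x \<in> W"
      using x by auto
    with Y W(1) obtain f where f: "continuous_map Y euclideanreal f" "bv_on (topspace Y) L f"
      "f (\<phi> x) = 1" "\<forall>y\<in>topspace Y - W. f y = 0"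
      unfolding bv_separated_def by blast
    have "continuous_map X euclideanreal (f \<circ> \<phi>)"
      by (rule continuous_map_compose[OF cont f(1)])
    moreover have "bv_on (topspace X) K (f \<circ> \<phi>)"
    proof -
      obtain B where B: "\<And>ys. ys \<in> ascending (topspace Y) L \<Longrightarrow> var1 f ys \<le> B"
        using bv_onE[OF f(2)] by blast
      have "map \<phi> xs \<in> ascending (topspace Y) L" if "xs \<in> ascending (topspace X) K" for xs
        using that \<phi>_Y
        by (auto simp: ascending_def sorted_wrt_map K_def intro: sorted_wrt_mono_rel[rotated])
      with B show ?thesis
        by (intro bv_onI[where K = B]) (simp add: var1_map[symmetric])
    qed
    moreover have "(f \<circ> \<phi>) y = 0" if "y \<in> topspace X - U" for y
    proof -
      have "\<phi> y \<notin> \<phi> ` U"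
        using inj that openin_subset[OF U] by (auto dest: inj_onD)
      with W(2) \<open>\<phi> ` topspace X = A\<close> that have "\<phi> y \<notin> W"
        by auto
      with f(4) \<phi>_Y that show ?thesis
        by auto
    qed
    ultimately show "\<exists>f. continuous_map X euclideanreal f \<and> bv_on (topspace X) K f \<and> f x = 1 \<and>
        (\<forall>y\<in>topspace X - U. f y = 0)"
      using f(3) by (intro exI[of _ "f \<circ> \<phi>"]) auto
  qed
qed

section \<open>Functions of bounded variation on ordered spaces\<close>

text \<open>The bound \<open>0 \<le> u\<close> is there because \<open>dyadics\<close> contains
  nonnegative numbers only.\<close>

lemma ex_dyadic_between:
  fixes u v :: real
  assumes "0 \<le> u" "u < v"
  shows "\<exists>q\<in>dyadics. u < q \<and> q < v"
proof -
  have "0 < (v - u) / 2" "1 < (2::real)" "0 \<le> (u + v) / 2"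
    using assms by auto
  \<comment> \<open>The midpoint is straddled with a gap below half the length of the interval, so
    the upper approximation stays below \<open>v\<close>.\<close>
  then obtain n q r where "of_nat q / 2 ^ n \<le> (u + v) / 2" "(u + v) / 2 < of_nat r / 2 ^ n"
    "\<bar>of_nat q / 2 ^ n - of_nat r / 2 ^ n\<bar> < (v - u) / (2::real)"
    by (rule padic_rational_approximation_straddle_pos_le)
  then have "u < of_nat r / 2 ^ n" "of_nat r / 2 ^ n < v"
    using assms by (auto simp: abs_less_iff field_simps)
  moreover have "of_nat r / 2 ^ n \<in> (dyadics :: real set)"
    by (auto simp: dyadics_def)
  ultimately show ?thesis
    by blast
qed

text \<open>A monotone Urysohn lemma. Semicontinuity is expressed by rays of \<open>r\<close>, since in the circular
  case the downward rays will not be open.\<close>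

definition ray_continuous :: "'a set \<Rightarrow> ('a \<times> 'a) set \<Rightarrow> ('a \<Rightarrow> real) \<Rightarrow> bool" where
  "ray_continuous S r g \<longleftrightarrow>
     (\<forall>x\<in>S. \<forall>k. 0 \<le> k \<longrightarrow> k < g x \<longrightarrow> (\<exists>s. (s, x) \<in> r - Id \<and> (\<forall>y. (s, y) \<in> r - Id \<longrightarrow> k < g y))) \<and>
     (\<forall>x\<in>S. \<forall>k. k \<le> 1 \<longrightarrow> g x < k \<longrightarrow> (\<exists>s. (x, s) \<in> r - Id \<and> (\<forall>y. (y, s) \<in> r - Id \<longrightarrow> g y < k)))"

text \<open>Either the order jumps somewhere between \<open>a\<close> and \<open>b\<close>, and the
  indicator of everything from the upper end of the jump on will do; or the stretch from
  \<open>a\<close> to \<open>b\<close> is dense in itself, and the Urysohn construction runs along a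
  chain of points indexed by dyadic numbers.\<close>

lemma monotone_Urysohn:
  assumes r: "linear_order_on S r" and ab: "(a, b) \<in> r - Id"
  obtains g :: "'a \<Rightarrow> real" where
    "\<And>x. 0 \<le> g x" "\<And>x. g x \<le> 1" "\<And>x y. (x, y) \<in> r \<Longrightarrow> g x \<le> g y"
    "\<And>x. (x, a) \<in> r \<Longrightarrow> g x = 0" "\<And>x. (b, x) \<in> r \<Longrightarrow> g x = 1" "ray_continuous S r g"
proof -
  have sub: "r \<subseteq> S \<times> S" and refl: "\<And>x. x \<in> S \<Longrightarrow> (x, x) \<in> r"
    and tr: "\<And>x y z. (x, y) \<in> r \<Longrightarrow> (y, z) \<in> r \<Longrightarrow> (x, z) \<in> r"
    and anti: "\<And>x y. (x, y) \<in> r \<Longrightarrow> (y, x) \<in> r \<Longrightarrow> x = y"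
    and tot: "\<And>x y. x \<in> S \<Longrightarrow> y \<in> S \<Longrightarrow> (x, y) \<in> r \<or> (y, x) \<in> r"
    using r unfolding order_on_defs refl_on_def total_on_def
    by (blast, blast, blast dest: transD, blast dest: antisymD, metis)
  have aS: "a \<in> S" and bS: "b \<in> S" and ab_r: "(a, b) \<in> r"
    using ab sub by auto
  show thesis
  proof (cases "\<forall>c d. (a, c) \<in> r \<and> (c, d) \<in> r - Id \<and> (d, b) \<in> r \<longrightarrow>
      (\<exists>u. (c, u) \<in> r - Id \<and> (u, d) \<in> r - Id)")
    case False
    then obtain c d where cd: "(a, c) \<in> r" "(c, d) \<in> r" "c \<noteq> d" "(d, b) \<in> r"
      and jump: "\<And>u. (c, u) \<in> r - Id \<Longrightarrow> (u, d) \<notin> r - Id"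
      by blast
    have up: "(d, y) \<in> r" if "(c, y) \<in> r - Id" for y
      using jump[OF that] that cd sub tot[of y d] refl by blast
    define g :: "'a \<Rightarrow> real" where "g x = (if (d, x) \<in> r then 1 else 0)" for x
    show thesis
    proof (rule that[of g])
      show "g x \<le> g y" if "(x, y) \<in> r" for x y
        using tr[OF _ that, of d] by (auto simp: g_def)
      show "g x = 0" if "(x, a) \<in> r" for x
        using tr[OF _ tr[OF that cd(1)], of d] anti cd by (auto simp: g_def)
      show "g x = 1" if "(b, x) \<in> r" for x
        using tr[OF cd(4) that] by (simp add: g_def)
      show "ray_continuous S r g"
        unfolding ray_continuous_def
      proof (intro conjI ballI allI impI)
        fix x k assume "x \<in> S" "0 \<le> k" "k < g x"
        then have "(d, x) \<in> r" "k < 1"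
          by (auto simp: g_def split: if_splits)
        \<comment> \<open>The lower end \<open>c\<close> of the jump serves as the end of the ray:
          whatever is strictly above \<open>c\<close> is already at or above
          \<open>d\<close>.\<close>
        then have "(c, x) \<in> r - Id"
          using tr anti cd by blast
        with up \<open>k < 1\<close> show "\<exists>s. (s, x) \<in> r - Id \<and> (\<forall>y. (s, y) \<in> r - Id \<longrightarrow> k < g y)"
          by (auto simp: g_def)
      next
        fix x k assume x: "x \<in> S" and k: "k \<le> 1" "g x < k"
        then have "(d, x) \<notin> r" "0 < k"
          by (auto simp: g_def split: if_splits)
        then have "(x, d) \<in> r - Id"
          using x tot[of x d] cd sub by auto
        moreover have "g y < k" if "(y, d) \<in> r - Id" for y
          using that anti \<open>0 < k\<close> by (auto simp: g_def)
        ultimately show "\<exists>s. (x, s) \<in> r - Id \<and> (\<forall>y. (y, s) \<in> r - Id \<longrightarrow> g y < k)"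
          by blast
      qed
    qed (auto simp: g_def)
  next
    case dense: True
    define R where "R x y \<longleftrightarrow> (a, x) \<in> r \<and> (x, y) \<in> r \<and> x \<noteq> y \<and> (y, b) \<in> r" for x y
    have "R a b"
      using ab_r ab aS bS refl by (auto simp: R_def)
    moreover have "\<exists>z. R x z \<and> R z y" if "R x y" for x y
    proof -
      have "(a, x) \<in> r" "(x, y) \<in> r - Id" "(y, b) \<in> r"
        using that by (auto simp: R_def)
      then obtain z where "(x, z) \<in> r - Id" "(z, y) \<in> r - Id"
        using dense by blast
      with \<open>(a, x) \<in> r\<close> \<open>(y, b) \<in> r\<close> show ?thesis
        unfolding R_def by (blast intro: tr)
    qed
    moreover have "R x z" if "R x y" "R y z" for x y z
      using that tr anti unfolding R_def by blast
    ultimately have "\<exists>e :: real \<Rightarrow> 'a. e 0 = a \<and> e 1 = b \<and>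
        (\<forall>x\<in>dyadics \<inter> {0..1}. \<forall>y\<in>dyadics \<inter> {0..1}. x < y \<longrightarrow> R (e x) (e y))"
      by (rule recursion_on_dyadic_fractions)
    then obtain e :: "real \<Rightarrow> 'a" where e0: "e 0 = a" and e1: "e 1 = b"
      and e: "\<forall>x\<in>dyadics \<inter> {0..1}. \<forall>y\<in>dyadics \<inter> {0..1}. x < y \<longrightarrow> R (e x) (e y)"
      by blast
    define D :: "real set" where "D = dyadics \<inter> {0..1}"
    have D01: "0 \<in> D" "1 \<in> D"
      using real_in_dyadics[of 0] real_in_dyadics[of 1] by (auto simp: D_def)
    have e_less: "(e p, e q) \<in> r - Id" if "p \<in> D" "q \<in> D" "p < q" for p q
      using e that by (auto simp: D_def R_def)
    have e_S: "e q \<in> S" if "q \<in> D" for q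
      using e_less[OF D01(1) that] e0 aS sub that by (cases "q = 0") (auto simp: D_def)
    define A where "A x = {q \<in> D. q = 0 \<or> (e q, x) \<in> r}" for x
    define g where "g x = Sup (A x)" for x
    have A0: "0 \<in> A x" for x
      using D01 by (simp add: A_def)
    have A1: "q \<le> 1" if "q \<in> A x" for q x
      using that by (auto simp: A_def D_def)
    have bdd: "bdd_above (A x)" for x
      by (rule bdd_aboveI[OF A1])
    have g_ge: "q \<le> g x" if "q \<in> A x" for q x
      unfolding g_def by (rule cSup_upper[OF that bdd])
    have g_le: "g x \<le> K" if "\<And>q. q \<in> A x \<Longrightarrow> q \<le> K" for K x
      unfolding g_def using A0[of x] by (intro cSup_least that) auto
    have mono: "g x \<le> g y" if "(x, y) \<in> r" for x y
      by (intro g_le g_ge) (use tr[OF _ that] in \<open>auto simp: A_def\<close>)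
    have g_e: "g (e q) = q" if "q \<in> D" for q
    proof (rule antisym)
      show "g (e q) \<le> q"
      proof (rule g_le, rule ccontr)
        fix p assume p: "p \<in> A (e q)" "\<not> p \<le> q"
        moreover have "0 \<le> q"
          using that by (simp add: D_def)
        ultimately have "p \<in> D" "(e p, e q) \<in> r"
          by (auto simp: A_def)
        with e_less[OF that \<open>p \<in> D\<close>] p(2) anti show False
          by auto
      qed
      show "q \<le> g (e q)"
        by (rule g_ge) (use that refl[OF e_S[OF that]] in \<open>simp add: A_def\<close>)
    qed
    have between: "\<exists>q\<in>D. u < q \<and> q < v" if "0 \<le> u" "u < v" "v \<le> 1" for u v
      using ex_dyadic_between[OF that(1,2)] that by (force simp: D_def)
    show thesis
    proof (rule that[of g])
      show g_nonneg: "0 \<le> g x" for x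
        by (rule g_ge[OF A0])
      show "g x \<le> 1" for x
        by (rule g_le[OF A1])
      show "g x = 0" if "(x, a) \<in> r" for x
        using mono[OF that] g_e[OF D01(1)] g_nonneg[of x] by (simp add: e0)
      show "g x = 1" if "(b, x) \<in> r" for x
        using mono[OF that] g_e[OF D01(2)] g_le[OF A1, of x] by (simp add: e1)
      show "ray_continuous S r g"
        unfolding ray_continuous_def
      proof (intro conjI ballI allI impI)
        fix x k assume x: "x \<in> S" and k: "0 \<le> k" "k < g x"
        then obtain p where p: "p \<in> A x" "k < p"
          using less_cSupE[of k "A x"] A0 unfolding g_def by blast
        then have pD: "p \<in> D" "(e p, x) \<in> r"
          using k(1) by (auto simp: A_def)
        \<comment> \<open>Stepping back from \<open>p\<close> to \<open>q\<close> puts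
          \<open>e q\<close> strictly below \<open>x\<close>, while every point above
          \<open>e q\<close> still has value at least \<open>q\<close>.\<close>
        obtain q where q: "q \<in> D" "k < q" "q < p"
          using between[of k p] k(1) p(2) A1[OF p(1)] by blast
        have "(e q, x) \<in> r - Id"
          using e_less[OF q(1) pD(1) q(3)] pD(2) tr anti by blast
        moreover have "k < g y" if "(e q, y) \<in> r - Id" for y
          using g_ge[of q y] q that by (simp add: A_def)
        ultimately show "\<exists>s. (s, x) \<in> r - Id \<and> (\<forall>y. (s, y) \<in> r - Id \<longrightarrow> k < g y)"
          by blast
      next
        fix x k assume x: "x \<in> S" and k: "k \<le> 1" "g x < k"
        \<comment> \<open>As \<open>q\<close> exceeds \<open>g x\<close>, the point
          \<open>e q\<close> lies strictly above \<open>x\<close>, and points below it have value at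
          most \<open>g (e q) = q\<close>.\<close>
        obtain q where q: "q \<in> D" "g x < q" "q < k"
          using between[OF g_ge[OF A0] k(2) k(1)] by blast
        then have "(e q, x) \<notin> r"
          using g_ge[of q x] by (auto simp: A_def)
        then have "(x, e q) \<in> r - Id"
          using tot[OF x e_S[OF q(1)]] refl[OF x] by auto
        moreover have "g y < k" if "(y, e q) \<in> r - Id" for y
          using mono[of y "e q"] that g_e[OF q(1)] q(3) by auto
        ultimately show "\<exists>s. (x, s) \<in> r - Id \<and> (\<forall>y. (y, s) \<in> r - Id \<longrightarrow> g y < k)"
          by blast
      qed
    qed (fact mono)
  qed
qed

section \<open>Constants and products of functions of bounded variation\<close>

lemma bv_on_const: "bv_on S L (\<lambda>_. c)"
  by (rule bv_on_monotone[where B = "\<bar>c\<bar>"]) auto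

lemma bv_on_bounded:
  assumes "bv_on S L f"
  obtains B where "0 \<le> B" "\<And>x. x \<in> S \<Longrightarrow> \<bar>f x\<bar> \<le> B"
proof -
  obtain K where K: "0 \<le> K" "\<And>xs. xs \<in> ascending S L \<Longrightarrow> var1 f xs \<le> K"
    using bv_onE[OF assms] by blast
  have "\<bar>f x\<bar> \<le> K" if "x \<in> S" for x
    using K(2)[of "[x]"] that by (simp add: ascending_def var1_def incr_def lessThan_Suc)
  with K(1) show thesis
    by (rule that)
qed

lemma bv_on_mult:
  assumes f: "bv_on S L f" and g: "bv_on S L g"
  shows "bv_on S L (\<lambda>x. f x * g x)"
proof -
  obtain A where A: "0 \<le> A" "\<And>x. x \<in> S \<Longrightarrow> \<bar>f x\<bar> \<le> A"
    using bv_on_bounded[OF f] by blast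
  obtain B where B: "0 \<le> B" "\<And>x. x \<in> S \<Longrightarrow> \<bar>g x\<bar> \<le> B"
    using bv_on_bounded[OF g] by blast
  obtain K where K: "\<And>xs. xs \<in> ascending S L \<Longrightarrow> var1 f xs \<le> K"
    using bv_onE[OF f] by blast
  obtain M where M: "\<And>xs. xs \<in> ascending S L \<Longrightarrow> var1 g xs \<le> M"
    using bv_onE[OF g] by blast
  show ?thesis
  proof (rule bv_onI)
    fix xs assume xs: "xs \<in> ascending S L"
    have "\<bar>incr (\<lambda>x. f x * g x) xs i\<bar> \<le> A * \<bar>incr g xs i\<bar> + B * \<bar>incr f xs i\<bar>"
      if i: "i < length xs" for i
    proof (cases i)
      case 0
      have "\<bar>f (xs ! 0)\<bar> \<le> A"
        using xs i 0 by (intro A) (auto simp: ascending_def)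
      then have "\<bar>f (xs ! 0)\<bar> * \<bar>g (xs ! 0)\<bar> \<le> A * \<bar>g (xs ! 0)\<bar>"
        by (rule mult_right_mono) simp
      moreover have "0 \<le> B * \<bar>f (xs ! 0)\<bar>"
        using B(1) by simp
      ultimately show ?thesis
        using 0 by (simp add: incr_def abs_mult)
    next
      case (Suc j)
      have fA: "\<bar>f (xs ! i)\<bar> \<le> A"
        using xs i by (intro A) (auto simp: ascending_def)
      have gB: "\<bar>g (xs ! j)\<bar> \<le> B"
        using xs i Suc by (intro B) (auto simp: ascending_def)
      have "incr (\<lambda>x. f x * g x) xs i = f (xs ! i) * incr g xs i + g (xs ! j) * incr f xs i"
        using Suc by (simp add: incr_def algebra_simps)
      then have "\<bar>incr (\<lambda>x. f x * g x) xs i\<bar>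
          \<le> \<bar>f (xs ! i)\<bar> * \<bar>incr g xs i\<bar> + \<bar>g (xs ! j)\<bar> * \<bar>incr f xs i\<bar>"
        by (metis abs_mult abs_triangle_ineq)
      also have "\<dots> \<le> A * \<bar>incr g xs i\<bar> + B * \<bar>incr f xs i\<bar>"
        using fA gB by (intro add_mono mult_right_mono) auto
      finally show ?thesis .
    qed
    then have "var1 (\<lambda>x. f x * g x) xs \<le> (\<Sum>i<length xs. A * \<bar>incr g xs i\<bar> + B * \<bar>incr f xs i\<bar>)"
      unfolding var1_def by (intro sum_mono) auto
    also have "\<dots> = A * var1 g xs + B * var1 f xs"
      by (simp add: var1_def sum.distrib sum_distrib_left)
    also have "\<dots> \<le> A * M + B * K"
      using A(1) B(1) K[OF xs] M[OF xs] by (intro add_mono mult_left_mono)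
    finally show "var1 (\<lambda>x. f x * g x) xs \<le> A * M + B * K" .
  qed
qed

text \<open>Separating functions are found by induction on how an open set is generated: monotone
  Urysohn functions between \<open>x\<close> and the end of a ray, products for intersections. All
  rays being open here, \<open>ray_continuous\<close> gives continuity.\<close>

lemma LOTS_bv_separated:
  assumes "LOTS Y"
  shows "\<exists>L. bv_separated Y L"
proof -
  define S where "S = topspace Y"
  obtain r where r: "linear_order_on S r"
    and Y: "Y = topology_generated_by (insert S (open_rays S r))"
    using assms unfolding LOTS_def S_def by blast
  have sub: "r \<subseteq> S \<times> S"
    using r by (simp add: order_on_defs)
  have tot: "(x, y) \<in> r - Id \<or> (y, x) \<in> r - Id" if "x \<in> S" "y \<in> S" "x \<noteq> y" for x y
    using r that unfolding order_on_defs total_on_def by blast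
  have anti: "x = y" if "(x, y) \<in> r" "(y, x) \<in> r" for x y
    using r that unfolding order_on_defs by (blast dest: antisymD)
  have down_open: "openin Y {y. (y, s) \<in> r - Id}" if "s \<in> S" for s
  proof -
    have "{y. (y, s) \<in> r - Id} = {y \<in> S. (y, s) \<in> r - Id}"
      using sub by auto
    then show ?thesis
      using that unfolding Y by (auto simp: open_rays_def intro!: topology_generated_by_Basis)
  qed
  have up_open: "openin Y {y. (s, y) \<in> r - Id}" if "s \<in> S" for s
  proof -
    have "{y. (s, y) \<in> r - Id} = {y \<in> S. (s, y) \<in> r - Id}"
      using sub by auto
    then show ?thesis
      using that unfolding Y by (auto simp: open_rays_def intro!: topology_generated_by_Basis)
  qed
  have continuous: "continuous_map Y euclideanreal g"
    if g: "\<And>x. 0 \<le> g x" "\<And>x. g x \<le> 1" and ray: "ray_continuous S r g" for g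
    unfolding continuous_map_upper_lower_semicontinuous_lt
  proof (intro conjI allI)
    fix k :: real
    show "openin Y {x \<in> topspace Y. k < g x}"
    proof (cases "0 \<le> k")
      case True
      show ?thesis
      proof (subst openin_subopen, intro ballI)
        fix x assume x: "x \<in> {x \<in> topspace Y. k < g x}"
        then obtain s where s: "(s, x) \<in> r - Id" "\<forall>y. (s, y) \<in> r - Id \<longrightarrow> k < g y"
          using ray True unfolding ray_continuous_def S_def by blast
        have "{y. (s, y) \<in> r - Id} \<subseteq> {x \<in> topspace Y. k < g x}"
          using s(2) sub by (auto simp: S_def)
        with s(1) up_open[of s] sub
        show "\<exists>T. openin Y T \<and> x \<in> T \<and> T \<subseteq> {x \<in> topspace Y. k < g x}"
          by (intro exI[of _ "{y. (s, y) \<in> r - Id}"]) auto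
      qed
    next
      case False
      then have "{x \<in> topspace Y. k < g x} = topspace Y"
        using order_less_le_trans[OF _ g(1)] by (auto simp: not_le)
      then show ?thesis
        by simp
    qed
    show "openin Y {x \<in> topspace Y. g x < k}"
    proof (cases "k \<le> 1")
      case True
      show ?thesis
      proof (subst openin_subopen, intro ballI)
        fix x assume x: "x \<in> {x \<in> topspace Y. g x < k}"
        then obtain s where s: "(x, s) \<in> r - Id" "\<forall>y. (y, s) \<in> r - Id \<longrightarrow> g y < k"
          using ray True unfolding ray_continuous_def S_def by blast
        have "{y. (y, s) \<in> r - Id} \<subseteq> {x \<in> topspace Y. g x < k}"
          using s(2) sub by (auto simp: S_def)
        with s(1) down_open[of s] sub
        show "\<exists>T. openin Y T \<and> x \<in> T \<and> T \<subseteq> {x \<in> topspace Y. g x < k}"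
          by (intro exI[of _ "{y. (y, s) \<in> r - Id}"]) auto
      qed
    next
      case False
      then have "{x \<in> topspace Y. g x < k} = topspace Y"
        using order_le_less_trans[OF g(2)] by (auto simp: not_le)
      then show ?thesis
        by simp
    qed
  qed
  have separating: "\<exists>g. continuous_map Y euclideanreal g \<and> bv_on S r g \<and>
      (\<forall>x. (x, a) \<in> r \<longrightarrow> g x = 0) \<and> (\<forall>x. (b, x) \<in> r \<longrightarrow> g x = 1)" if ab: "(a, b) \<in> r - Id" for a b
  proof -
    obtain g :: "'a \<Rightarrow> real" where g: "\<And>x. 0 \<le> g x" "\<And>x. g x \<le> 1"
      "\<And>x y. (x, y) \<in> r \<Longrightarrow> g x \<le> g y" "\<And>x. (x, a) \<in> r \<Longrightarrow> g x = 0"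
      "\<And>x. (b, x) \<in> r \<Longrightarrow> g x = 1" "ray_continuous S r g"
      by (rule monotone_Urysohn[OF r ab]) (rule that)
    have "bv_on S r g"
      using g(1,2) by (intro bv_on_monotone[where B = 1] g(3)) auto
    with continuous[OF g(1,2,6)] g(4,5) show ?thesis
      by blast
  qed
  have refl: "(x, x) \<in> r" if "x \<in> S" for x
    using r that by (auto simp: order_on_defs refl_on_def)
  have "\<exists>f. continuous_map Y euclideanreal f \<and> bv_on S r f \<and> f x = 1 \<and> (\<forall>y\<in>S - U. f y = 0)"
    if "generate_topology_on (insert S (open_rays S r)) U" "x \<in> U" for U x
    using that
  proof (induction U arbitrary: x rule: generate_topology_on.induct)
    case (Int U W)
    obtain f where f: "continuous_map Y euclideanreal f" "bv_on S r f" "f x = 1"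
      "\<forall>y\<in>S - U. f y = 0"
      using Int.IH(1)[of x] Int.prems by auto
    obtain g where g: "continuous_map Y euclideanreal g" "bv_on S r g" "g x = 1"
      "\<forall>y\<in>S - W. g y = 0"
      using Int.IH(2)[of x] Int.prems by auto
    show ?case
      using f g by (intro exI[of _ "\<lambda>y. f y * g y"])
        (auto intro: bv_on_mult continuous_map_real_mult)
  next
    case (UN K)
    then obtain U where U: "U \<in> K" "x \<in> U"
      by blast
    with UN.IH[OF U] show ?case
      by blast
  next
    case (Basis U)
    then consider "U = S" | a where "a \<in> S" "U = {y \<in> S. (y, a) \<in> r - Id}"
      | a where "a \<in> S" "U = {y \<in> S. (a, y) \<in> r - Id}"
      by (auto simp: open_rays_def)
    then show ?case
    proof cases
      case 1
      then show ?thesis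
        by (intro exI[of _ "\<lambda>_. 1"]) (simp add: bv_on_const)
    next
      \<comment> \<open>For a downward ray the function must fall from \<open>x\<close> to
        \<open>a\<close>, hence \<open>1 - g\<close>.\<close>
      case 2
      then have xa: "(x, a) \<in> r - Id" "x \<in> S"
        using Basis.prems by auto
      from separating[OF xa(1)] obtain g where g: "continuous_map Y euclideanreal g" "bv_on S r g"
        "\<forall>y. (y, x) \<in> r \<longrightarrow> g y = 0" "\<forall>y. (a, y) \<in> r \<longrightarrow> g y = 1"
        by blast
      have "1 - g y = 0" if "y \<in> S - U" for y
      proof -
        have "(a, y) \<in> r"
          using that 2 tot[of y a] refl[of a] by (cases "y = a") auto
        with g(4) show ?thesis
          by simp
      qed
      moreover have "bv_on S r (\<lambda>y. 1 - g y)"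
        using bv_on_diff[OF bv_on_const[of S r 1] g(2)] by (rule bv_on_cong) simp
      ultimately show ?thesis
        using g(1,3) refl[OF xa(2)] by (intro exI[of _ "\<lambda>y. 1 - g y"])
          (auto intro: continuous_map_diff)
    next
      case 3
      then have ax: "(a, x) \<in> r - Id" "x \<in> S"
        using Basis.prems by auto
      from separating[OF ax(1)] obtain g where g: "continuous_map Y euclideanreal g" "bv_on S r g"
        "\<forall>y. (y, a) \<in> r \<longrightarrow> g y = 0" "\<forall>y. (x, y) \<in> r \<longrightarrow> g y = 1"
        by blast
      have "g y = 0" if "y \<in> S - U" for y
      proof -
        have "(y, a) \<in> r"
          using that 3 tot[of y a] refl[of a] by (cases "y = a") auto
        with g(3) show ?thesis
          by simp
      qed
      then show ?thesis
        using g(1,2,4) refl[OF ax(2)] by blast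
    qed
  qed auto
  then have sep: "\<exists>f. continuous_map Y euclideanreal f \<and> bv_on S r f \<and> f x = 1 \<and> (\<forall>y\<in>S - U. f y = 0)"
    if "openin Y U" "x \<in> U" for U x
    using that unfolding Y openin_topology_generated_by_iff by blast
  have "t0_space Y"
    unfolding t0_space_def
  proof (intro ballI impI)
    fix x y assume xy: "x \<in> topspace Y" "y \<in> topspace Y" "x \<noteq> y"
    from tot[of x y] xy have "openin Y {z. (z, y) \<in> r - Id} \<and> (x, y) \<in> r - Id \<or>
        openin Y {z. (y, z) \<in> r - Id} \<and> (y, x) \<in> r - Id"
      using down_open[of y] up_open[of y] unfolding S_def by blast
    then show "\<exists>U. openin Y U \<and> (x \<notin> U) = (y \<in> U)"
      by blast
  qed
  with r sep show ?thesis
    unfolding bv_separated_def S_def by blast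
qed

section \<open>Circularly ordered spaces\<close>

text \<open>The circle traversed once starting from \<open>p\<close>, which becomes the least
  element.\<close>

definition cut_order :: "'a set \<Rightarrow> ('a \<times> 'a \<times> 'a) set \<Rightarrow> 'a \<Rightarrow> ('a \<times> 'a) set" where
  "cut_order S R p = {(s, t). s \<in> S \<and> t \<in> S \<and> (s = p \<or> s = t \<or> (p, s, t) \<in> R)}"

locale circular_order =
  fixes S :: "'a set" and R :: "('a \<times> 'a \<times> 'a) set"
  assumes circular: "circular_order_on S R"
begin

lemma cyclic: "(a, b, c) \<in> R \<Longrightarrow> (b, c, a) \<in> R"
  by (rule circular[unfolded circular_order_on_def, THEN conjunct2, THEN conjunct1, rule_format])

lemma asymmetric: "(a, b, c) \<in> R \<Longrightarrow> (c, b, a) \<notin> R"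
  by (rule circular[unfolded circular_order_on_def, THEN conjunct2, THEN conjunct2, THEN conjunct1,
        rule_format])

lemma transitive: "(a, b, c) \<in> R \<Longrightarrow> (a, c, d) \<in> R \<Longrightarrow> (a, b, d) \<in> R"
  by (rule circular[unfolded circular_order_on_def, THEN conjunct2, THEN conjunct2, THEN conjunct2,
        THEN conjunct1, rule_format]) (rule conjI)

lemma total: "a \<in> S \<Longrightarrow> b \<in> S \<Longrightarrow> c \<in> S \<Longrightarrow> a \<noteq> b \<Longrightarrow> b \<noteq> c \<Longrightarrow> a \<noteq> c \<Longrightarrow>
    (a, b, c) \<in> R \<or> (a, c, b) \<in> R"
  using circular[unfolded circular_order_on_def, THEN conjunct2, THEN conjunct2, THEN conjunct2,
        THEN conjunct2] by simp

lemma in_carrier: "(a, b, c) \<in> R \<Longrightarrow> a \<in> S \<and> b \<in> S \<and> c \<in> S"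
  using circular[unfolded circular_order_on_def, THEN conjunct1] by auto

lemma distinct: "(a, b, c) \<in> R \<Longrightarrow> a \<noteq> b \<and> b \<noteq> c \<and> a \<noteq> c"
  by (metis cyclic asymmetric)

lemma linear_order_cut_order:
  assumes "p \<in> S"
  shows "linear_order_on S (cut_order S R p)"
  unfolding order_on_defs
proof (intro conjI)
  show "cut_order S R p \<subseteq> S \<times> S"
    by (auto simp: cut_order_def)
  show "refl_on S (cut_order S R p)"
    by (auto simp: cut_order_def refl_on_def)
  show "trans (cut_order S R p)"
  proof (rule transI)
    fix x y z assume "(x, y) \<in> cut_order S R p" "(y, z) \<in> cut_order S R p"
    then show "(x, z) \<in> cut_order S R p"
      unfolding cut_order_def mem_Collect_eq prod.case by (metis transitive distinct)
  qed
  show "antisym (cut_order S R p)"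
  proof (rule antisymI)
    fix x y assume "(x, y) \<in> cut_order S R p" "(y, x) \<in> cut_order S R p"
    then show "x = y"
      unfolding cut_order_def mem_Collect_eq prod.case by (metis cyclic asymmetric distinct)
  qed
  show "total_on S (cut_order S R p)"
    unfolding total_on_def cut_order_def mem_Collect_eq prod.case using total assms by metis
qed

lemma strict_cut_iff:
  "(s, t) \<in> cut_order S R p - Id \<longleftrightarrow> s \<in> S \<and> t \<in> S \<and> s \<noteq> t \<and> (s = p \<or> (p, s, t) \<in> R)"
  by (auto simp: cut_order_def)

text \<open>Both parts \<open>A = {t. t < p}\<close> and \<open>B = {t. p \<le> t}\<close> of the order cut at \<open>z\<close> are ordered the
  same way by the order cut at \<open>p\<close>, so that \<open>g\<close> is the sum of the monotone functions \<open>g\<close> on \<open>B\<close>,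
  \<open>g - 1\<close> on \<open>A\<close>, and of the antitone indicator of \<open>A\<close>.\<close>

lemma bv_on_cut_order:
  assumes zp: "z \<in> S" "p \<in> S"
    and g: "\<And>x. 0 \<le> g x" "\<And>x. g x \<le> 1" "\<And>x y. (x, y) \<in> cut_order S R p \<Longrightarrow> g x \<le> g y"
  shows "bv_on S (cut_order S R z) g"
proof -
  define B where "B = {t. (p, t) \<in> cut_order S R z}"
  have up: "y \<in> B" if "x \<in> B" "(x, y) \<in> cut_order S R z" for x y
    using linear_order_cut_order[OF zp(1)] that unfolding B_def order_on_defs by (blast dest: transD)
  have same: "(x, y) \<in> cut_order S R p" if xy: "(x, y) \<in> cut_order S R z" "x \<in> B \<longleftrightarrow> y \<in> B" for x y
  proof (cases "x \<in> B")
    case True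
    then show ?thesis
      using xy unfolding B_def cut_order_def mem_Collect_eq prod.case
      by (metis cyclic transitive distinct)
  next
    case False
    then have "y \<notin> B"
      using xy by simp
    have S: "x \<in> S" "y \<in> S"
      using xy by (auto simp: cut_order_def)
    have "x = z \<or> (z, x, p) \<in> R"
      using False S zp total[of z x p] by (auto simp: B_def cut_order_def)
    moreover have "y = z \<or> (z, y, p) \<in> R"
      using \<open>y \<notin> B\<close> S zp total[of z y p] by (auto simp: B_def cut_order_def)
    moreover have "x = z \<or> x = y \<or> (z, x, y) \<in> R"
      using xy by (simp add: cut_order_def)
    ultimately have "x = y \<or> (p, x, y) \<in> R"
      using cyclic transitive distinct by metis
    then show ?thesis
      using S by (auto simp: cut_order_def)
  qed
  have 1: "bv_on S (cut_order S R z) (\<lambda>x. if x \<in> B then g x else 0)"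
  proof (rule bv_on_monotone[where B = 1])
    fix x y assume "(x, y) \<in> cut_order S R z"
    then show "(if x \<in> B then g x else 0) \<le> (if y \<in> B then g y else 0)"
      using up[of x y] same[of x y] g by auto
  qed (use g in auto)
  \<comment> \<open>Subtracting 1 makes the values on the lower part nonpositive, so continuing by 0
    keeps the function monotone.\<close>
  have 2: "bv_on S (cut_order S R z) (\<lambda>x. if x \<in> B then 0 else g x - 1)"
  proof (rule bv_on_monotone[where B = 1])
    fix x y assume "(x, y) \<in> cut_order S R z"
    then show "(if x \<in> B then 0 else g x - 1) \<le> (if y \<in> B then 0 else g y - 1)"
      using up[of x y] same[of x y] g by auto
  qed (use g in auto)
  have 3: "bv_on S (cut_order S R z) (\<lambda>x. if x \<in> B then 0 else - 1)"
  proof (rule bv_on_monotone[where B = 1])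
    fix x y assume "(x, y) \<in> cut_order S R z"
    then show "(if x \<in> B then 0 else - 1) \<le> (if y \<in> B then 0 else - 1 :: real)"
      using up[of x y] by auto
  qed auto
  show ?thesis
    by (rule bv_on_cong[OF bv_on_diff[OF bv_on_add[OF 1 2] 3]]) simp
qed

end

section \<open>Open sets and bump functions of a circular space\<close>

locale circular_space = circular_order "topspace Y" R
  for Y :: "'a topology" and R +
  assumes base: "openin Y = arbitrary union_of (\<lambda>U. U \<in> circular_base (topspace Y) R)"
begin

abbreviation S :: "'a set" where
  "S \<equiv> topspace Y"

abbreviation open_arc :: "'a \<Rightarrow> 'a \<Rightarrow> 'a set" where
  "open_arc a b \<equiv> S - circular_interval S R a b"

lemma openin_arc:
  assumes "a \<in> S" "b \<in> S"
  shows "openin Y (open_arc a b)"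
proof -
  have "open_arc a b \<in> circular_base S R"
    using assms by (auto simp: circular_base_def)
  then show ?thesis
    unfolding base by (rule arbitrary_union_of_inc)
qed

lemma openin_base:
  assumes "openin Y U" "x \<in> U"
  obtains "U = S" | a b where "a \<in> S" "b \<in> S" "x \<in> open_arc a b" "open_arc a b \<subseteq> U"
proof -
  obtain B where B: "B \<in> circular_base S R" "x \<in> B" "B \<subseteq> U"
    using assms unfolding base arbitrary_union_of_alt by blast
  moreover have "U \<subseteq> S"
    using assms(1) by (rule openin_subset)
  ultimately show thesis
    unfolding circular_base_def using that by blast
qed

lemma openin_up:
  assumes "p \<in> S" "s \<in> S"
  shows "openin Y {y. (s, y) \<in> cut_order S R p - Id}"
proof -
  have "open_arc p s = {y. (s, y) \<in> cut_order S R p - Id}"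
  proof (intro set_eqI)
    fix y
    show "y \<in> open_arc p s \<longleftrightarrow> y \<in> {y. (s, y) \<in> cut_order S R p - Id}"
      using assms total[of p s y] unfolding mem_Collect_eq strict_cut_iff
      unfolding circular_interval_def mem_Collect_eq Diff_iff Un_iff insert_iff empty_iff
      by (metis asymmetric cyclic distinct)
  qed
  then show ?thesis
    using openin_arc[OF assms] by simp
qed

text \<open>A downward ray with the cut point \<open>p\<close> removed. For \<open>t = p\<close> the
  arc would be everything except \<open>p\<close>, not the empty set.\<close>

lemma openin_mid:
  assumes "p \<in> S" "t \<in> S" "t \<noteq> p"
  shows "openin Y {y. (p, y, t) \<in> R}"
proof -
  have "open_arc t p = {y. (p, y, t) \<in> R}"
  proof (intro set_eqI)
    fix y
    show "y \<in> open_arc t p \<longleftrightarrow> y \<in> {y. (p, y, t) \<in> R}"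
      using assms total[of p t y] in_carrier[of p y t]
      unfolding circular_interval_def mem_Collect_eq Diff_iff Un_iff insert_iff empty_iff
      by (metis asymmetric cyclic distinct)
  qed
  then show ?thesis
    using openin_arc[OF assms(2,1)] by simp
qed

text \<open>A downward ray of the order cut at \<open>p\<close> contains \<open>p\<close> and need not be open; it becomes a
  neighbourhood of \<open>p\<close> together with an upward ray.\<close>

lemma cut_point_neighbourhood:
  assumes s: "(p, s) \<in> cut_order S R p - Id" and t: "t \<in> S"
  shows "\<exists>T. openin Y T \<and> p \<in> T \<and> (\<forall>y\<in>T. (y, s) \<in> cut_order S R p - Id \<or> (t, y) \<in> cut_order S R p - Id)"
\<comment> \<open>If \<open>t\<close> lies below \<open>s\<close>, the two rays cover the whole
  space. Otherwise \<open>s\<close> is at or below \<open>t\<close>, and the complement of the arc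
  from \<open>s\<close> to \<open>t\<close> is a neighbourhood of \<open>p\<close>.\<close>
proof (cases "(t, s) \<in> cut_order S R p - Id")
  case True
  have "(y, s) \<in> cut_order S R p - Id \<or> (t, y) \<in> cut_order S R p - Id" if "y \<in> S" for y
  proof -
    have lin: "linear_order_on S (cut_order S R p)"
      using s by (intro linear_order_cut_order) (auto simp: cut_order_def)
    then have "y = t \<or> (t, y) \<in> cut_order S R p - Id \<or> (y, t) \<in> cut_order S R p - Id"
      using t that unfolding order_on_defs total_on_def by blast
    then show ?thesis
      using True lin unfolding order_on_defs by (blast dest: transD antisymD)
  qed
  moreover have "p \<in> S"
    using s by (auto simp: cut_order_def)
  ultimately show ?thesis
    by (intro exI[of _ S]) auto
next
  case False
  have pS: "p \<in> S" "s \<in> S" "s \<noteq> p"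
    using s by (auto simp: cut_order_def)
  have st: "s = t \<or> (p, s, t) \<in> R"
    using False pS t total[of p s t] unfolding strict_cut_iff by metis
  have "p \<in> open_arc s t"
    using pS st unfolding circular_interval_def mem_Collect_eq Diff_iff Un_iff insert_iff empty_iff
    by (metis asymmetric cyclic distinct)
  moreover have "(y, s) \<in> cut_order S R p - Id \<or> (t, y) \<in> cut_order S R p - Id" if "y \<in> open_arc s t" for y
  proof (rule ccontr)
    assume neg: "\<not> ?thesis"
    have y: "y \<in> S" "y \<noteq> s" "y \<noteq> t" "(s, y, t) \<notin> R"
      using that by (auto simp: circular_interval_def)
    have psy: "(p, s, y) \<in> R" and pyt: "(p, y, t) \<in> R"
      using neg y pS t st total[of p s y] total[of p y t]
      unfolding strict_cut_iff by (metis distinct)+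
    have "(s, y, t) \<in> R"
      by (rule cyclic[OF cyclic[OF transitive[OF cyclic[OF pyt] cyclic[OF cyclic[OF psy]]]]])
    with y show False
      by blast
  qed
  ultimately show ?thesis
    using openin_arc[OF pS(2) t] by blast
qed


text \<open>With the circle cut at \<open>b\<close>, the open arc starts just after \<open>b\<close>
  and ends at \<open>a\<close>, or at the top of the order if \<open>a = b\<close>. The function
  rises along \<open>g1\<close> from \<open>b\<close> to \<open>x\<close> and descends along
  \<open>g2\<close> after \<open>x\<close>.\<close>

lemma bump:
  assumes z: "z \<in> S" and ab: "a \<in> S" "b \<in> S" and x: "x \<in> open_arc a b"
  shows "\<exists>f. continuous_map Y euclideanreal f \<and> bv_on S (cut_order S R z) f \<and> f x = 1 \<and>
    (\<forall>y\<in>S - open_arc a b. f y = 0)"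
proof -
  define r where "r = cut_order S R b"
  have r: "linear_order_on S r"
    unfolding r_def by (rule linear_order_cut_order[OF ab(2)])
  have sub: "r \<subseteq> S \<times> S"
    using r by (simp add: order_on_defs)
  have tot: "x = y \<or> (x, y) \<in> r - Id \<or> (y, x) \<in> r - Id" if "x \<in> S" "y \<in> S" for x y
    using r that unfolding order_on_defs total_on_def by blast
  have refl: "(y, y) \<in> r" if "y \<in> S" for y
    using r that unfolding order_on_defs refl_on_def by blast
  have tr: "(x, z) \<in> r" if "(x, y) \<in> r" "(y, z) \<in> r" for x y z
    using r that unfolding order_on_defs by (blast dest: transD)
  have anti: "x = y" if "(x, y) \<in> r" "(y, x) \<in> r" for x y
    using r that unfolding order_on_defs by (blast dest: antisymD)
  have least: "(b, y) \<in> r" if "y \<in> S" for y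
    using that ab(2) by (simp add: r_def cut_order_def)
  have xS: "x \<in> S" "x \<noteq> a" "x \<noteq> b" "(a, x, b) \<notin> R"
    using x by (auto simp: circular_interval_def)
  have bx: "(b, x) \<in> r - Id"
    using least[OF xS(1)] xS(3) by auto
  obtain g1 :: "'a \<Rightarrow> real" where g1: "\<And>x. 0 \<le> g1 x" "\<And>x. g1 x \<le> 1"
    "\<And>x y. (x, y) \<in> r \<Longrightarrow> g1 x \<le> g1 y" "\<And>y. (y, b) \<in> r \<Longrightarrow> g1 y = 0"
    "\<And>y. (x, y) \<in> r \<Longrightarrow> g1 y = 1" "ray_continuous S r g1"
    by (rule monotone_Urysohn[OF r bx]) (rule that)
  \<comment> \<open>If \<open>a = b\<close>, the descent may end at any \<open>q\<close> above
    \<open>x\<close>, because only \<open>b\<close> has to be avoided. If \<open>x\<close> is the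
    greatest point, nothing lies above it and \<open>g2\<close> is 0.\<close>
  have "\<exists>g2 :: 'a \<Rightarrow> real. (\<forall>y. 0 \<le> g2 y) \<and> (\<forall>y. g2 y \<le> 1) \<and>
      (\<forall>y z. (y, z) \<in> r \<longrightarrow> g2 y \<le> g2 z) \<and> (\<forall>y. (y, x) \<in> r \<longrightarrow> g2 y = 0) \<and>
      (a \<noteq> b \<longrightarrow> (\<forall>y. (a, y) \<in> r \<longrightarrow> g2 y = 1)) \<and>
      (ray_continuous S r g2 \<and> (\<exists>q\<in>S. g2 q = 1) \<or> (\<forall>y. g2 y = 0) \<and> (\<forall>y\<in>S. (y, x) \<in> r))"
  proof -
    have from_q: ?thesis if q: "(x, q) \<in> r - Id" "a \<noteq> b \<Longrightarrow> q = a" for q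
    proof -
      obtain g2 :: "'a \<Rightarrow> real" where g2: "\<And>x. 0 \<le> g2 x" "\<And>x. g2 x \<le> 1"
        "\<And>x y. (x, y) \<in> r \<Longrightarrow> g2 x \<le> g2 y" "\<And>y. (y, x) \<in> r \<Longrightarrow> g2 y = 0"
        "\<And>y. (q, y) \<in> r \<Longrightarrow> g2 y = 1" "ray_continuous S r g2"
        by (rule monotone_Urysohn[OF r q(1)]) (rule that)
      have "q \<in> S"
        using q(1) sub by auto
      then have "\<exists>q\<in>S. g2 q = 1"
        using g2(5) refl by blast
      with g2 q(2) show ?thesis
        by (intro exI[of _ g2]) simp
    qed
    show ?thesis
    proof (cases "a = b")
      case False
      then have "(b, x, a) \<in> R"
        using total[of b x a] ab xS cyclic by metis
      then have "(x, a) \<in> r - Id"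
        using xS ab by (simp add: r_def cut_order_def)
      from from_q[OF this] show ?thesis
        by simp
    next
      case True
      show ?thesis
      proof (cases "\<exists>q. (x, q) \<in> r - Id")
        case True
        with \<open>a = b\<close> from_q show ?thesis
          by blast
      next
        case False
        then have "\<forall>y\<in>S. (y, x) \<in> r"
          using tot[OF xS(1)] refl[OF xS(1)] by blast
        with \<open>a = b\<close> show ?thesis
          by (intro exI[of _ "\<lambda>_. 0"]) simp
      qed
    qed
  qed
  then obtain g2 :: "'a \<Rightarrow> real" where g2: "\<And>y. 0 \<le> g2 y" "\<And>y. g2 y \<le> 1"
    "\<And>y z. (y, z) \<in> r \<Longrightarrow> g2 y \<le> g2 z" "\<And>y. (y, x) \<in> r \<Longrightarrow> g2 y = 0"
    "a \<noteq> b \<Longrightarrow> (\<forall>y. (a, y) \<in> r \<longrightarrow> g2 y = 1)"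
    and g2_cases: "ray_continuous S r g2 \<and> (\<exists>q\<in>S. g2 q = 1) \<or>
      (\<forall>y. g2 y = 0) \<and> (\<forall>y\<in>S. (y, x) \<in> r)"
    by blast
  define f where "f y = g1 y - g2 y" for y
  have f_low: "f y = g1 y" if "(y, x) \<in> r" for y
    using g2(4)[OF that] by (simp add: f_def)
  have f_high: "f y = 1 - g2 y" "g1 y = 1" if "(x, y) \<in> r" for y
    using g1(5)[OF that] by (simp_all add: f_def)
  have le_or_ge: "(y, x) \<in> r \<or> (x, y) \<in> r" if "y \<in> S" for y
    using tot[OF that xS(1)] refl[OF xS(1)] by blast
  \<comment> \<open>At each point of \<open>S\<close> either \<open>g2\<close> is 0 or
    \<open>g1\<close> is 1, so \<open>f\<close> is the minimum of \<open>g1\<close> and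
    \<open>1 - g2\<close>.\<close>
  have f_gt_iff: "k < f y \<longleftrightarrow> k < g1 y \<and> g2 y < 1 - k" if "y \<in> S" "k < 1" for y k
    using le_or_ge[OF that(1)] f_low[of y] f_high[of y] g2(4)[of y] that(2) by auto
  have f_lt_iff: "f y < k \<longleftrightarrow> g1 y < k \<or> 1 - k < g2 y" if "y \<in> S" "k \<le> 1" for y k
    using le_or_ge[OF that(1)] f_low[of y] f_high[of y] g2(4)[of y] that(2) by auto
  have f_bounds: "0 \<le> f y" "f y \<le> 1" if "y \<in> S" for y
    using le_or_ge[OF that] f_low[of y] f_high[of y] g1(1,2)[of y] g2(1,2)[of y] by auto
  have f_x: "f x = 1"
    using f_low[of x] g1(5)[of x] refl[OF xS(1)] by simp
  have f_b: "f b = 0" "g1 b = 0"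
    using f_low[of b] g1(4)[of b] refl[OF ab(2)] bx by auto
  have up: "openin Y {y. (s, y) \<in> r - Id}" if "s \<in> S" for s
    unfolding r_def by (rule openin_up[OF ab(2) that])
  \<comment> \<open>Downward rays are neighbourhoods of all their points except the cut point
    \<open>b\<close>.\<close>
  have low: "\<exists>T. openin Y T \<and> y \<in> T \<and> (\<forall>y'\<in>T. (y', t) \<in> r - Id)"
    if y: "(y, t) \<in> r - Id" "y \<noteq> b" for y t
  proof (intro exI conjI ballI)
    have t: "t \<in> S" "t \<noteq> b"
      using y sub least[of y] anti[of b y] by auto
    show "openin Y {y. (b, y, t) \<in> R}"
      by (rule openin_mid[OF ab(2) t])
    show "y \<in> {y. (b, y, t) \<in> R}"
      using y by (auto simp: r_def cut_order_def)
    show "(y', t) \<in> r - Id" if "y' \<in> {y. (b, y, t) \<in> R}" for y'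
      using that in_carrier[of b y' t] distinct[of b y' t] by (auto simp: r_def cut_order_def)
  qed
  have g2_gt: "\<exists>s. (s, y) \<in> r - Id \<and> (\<forall>y'. (s, y') \<in> r - Id \<longrightarrow> k < g2 y')"
    if "y \<in> S" "0 \<le> k" "k < g2 y" for y k
  proof -
    have "ray_continuous S r g2"
      using g2_cases that by auto
    with that show ?thesis
      unfolding ray_continuous_def by blast
  qed
  have continuous_f: "continuous_map Y euclideanreal f"
    unfolding continuous_map_upper_lower_semicontinuous_lt
  proof (intro conjI allI)
    fix k :: real
    consider "k < 0" | "0 \<le> k" "k < 1" | "1 \<le> k"
      by linarith
    then show "openin Y {y \<in> S. k < f y}"
    proof cases
      case 1
      then have "{y \<in> S. k < f y} = S"
        using order_less_le_trans[OF _ f_bounds(1)] by blast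
      then show ?thesis
        by (simp only: openin_topspace)
    next
      case 3
      then have "{y \<in> S. k < f y} = {}"
        using f_bounds(2) by force
      then show ?thesis
        by (simp only: openin_empty)
    next
      case 2
      show ?thesis
      proof (subst openin_subopen, intro ballI)
        fix y assume "y \<in> {y \<in> S. k < f y}"
        then have y: "y \<in> S" "k < g1 y" "g2 y < 1 - k"
          using f_gt_iff[OF _ 2(2)] by auto
        then obtain s where s: "(s, y) \<in> r - Id" "\<forall>y'. (s, y') \<in> r - Id \<longrightarrow> k < g1 y'"
          using g1(6) 2(1) unfolding ray_continuous_def by blast
        have "y \<noteq> b"
          using y(2) 2(1) f_b(2) by auto
        have "\<exists>T. openin Y T \<and> y \<in> T \<and> (\<forall>y'\<in>T. g2 y' < 1 - k)"
        proof (cases "ray_continuous S r g2")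
          case True
          have "1 - k \<le> 1"
            using 2(1) by simp
          then obtain t where t: "(y, t) \<in> r - Id" "\<forall>y'. (y', t) \<in> r - Id \<longrightarrow> g2 y' < 1 - k"
            using True y(1,3) unfolding ray_continuous_def by blast
          from low[OF t(1) \<open>y \<noteq> b\<close>] t(2) show ?thesis
            by blast
        next
          case False
          then have "\<forall>y. g2 y = 0"
            using g2_cases by blast
          then show ?thesis
            using y(1) 2(2) by (intro exI[of _ S]) auto
        qed
        then obtain T where T: "openin Y T" "y \<in> T" "\<forall>y'\<in>T. g2 y' < 1 - k"
          by blast
        have "s \<in> S"
          using s(1) sub by auto
        show "\<exists>T. openin Y T \<and> y \<in> T \<and> T \<subseteq> {y \<in> S. k < f y}"
        proof (intro exI conjI)
          show "openin Y ({y'. (s, y') \<in> r - Id} \<inter> T)"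
            using up[OF \<open>s \<in> S\<close>] T(1) by (rule openin_Int)
          show "y \<in> {y'. (s, y') \<in> r - Id} \<inter> T"
            using s(1) T(2) by simp
          show "{y'. (s, y') \<in> r - Id} \<inter> T \<subseteq> {y \<in> S. k < f y}"
            using s(2) T(3) f_gt_iff[OF _ 2(2)] sub by blast
        qed
      qed
    qed
  next
    fix k :: real
    consider "k \<le> 0" | "0 < k" "k \<le> 1" | "1 < k"
      by linarith
    then show "openin Y {y \<in> S. f y < k}"
    proof cases
      case 1
      then have "{y \<in> S. f y < k} = {}"
        using f_bounds(1) by force
      then show ?thesis
        by (simp only: openin_empty)
    next
      case 3
      then have "{y \<in> S. f y < k} = S"
        using order_le_less_trans[OF f_bounds(2)] by blast
      then show ?thesis
        by (simp only: openin_topspace)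
    next
      case 2
      have g1_lt: "\<exists>t. (y, t) \<in> r - Id \<and> (\<forall>y'. (y', t) \<in> r - Id \<longrightarrow> g1 y' < k)"
        if "y \<in> S" "g1 y < k" for y
        using g1(6) that 2(2) unfolding ray_continuous_def by blast
      show ?thesis
      proof (subst openin_subopen, intro ballI)
        fix y assume "y \<in> {y \<in> S. f y < k}"
        then have y: "y \<in> S" "g1 y < k \<or> 1 - k < g2 y"
          using f_lt_iff[OF _ 2(2)] by auto
        consider "y = b" | "y \<noteq> b" "g1 y < k" | "1 - k < g2 y"
          using y(2) by blast
        then show "\<exists>T. openin Y T \<and> y \<in> T \<and> T \<subseteq> {y \<in> S. f y < k}"
        proof cases
          \<comment> \<open>Points near \<open>b\<close> come from both ends of the cut order: low
            ones, where \<open>g1\<close> is small, and high ones, where \<open>g2\<close> is close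
            to 1.\<close>
          case b: 1
          have "g1 b < k"
            using f_b(2) 2(1) by simp
          then obtain s where s: "(b, s) \<in> r - Id" "\<forall>y'. (y', s) \<in> r - Id \<longrightarrow> g1 y' < k"
            using g1_lt[OF ab(2)] by blast
          have "\<exists>t\<in>S. \<forall>y'. (t, y') \<in> r - Id \<longrightarrow> 1 - k < g2 y'"
          proof (cases "\<exists>q\<in>S. g2 q = 1")
            case True
            then obtain q where "q \<in> S" "0 \<le> 1 - k" "1 - k < g2 q"
              using 2 by auto
            from g2_gt[OF this] show ?thesis
              using sub by blast
          next
            case False
            then have "\<forall>y\<in>S. (y, x) \<in> r"
              using g2_cases by blast
            then show ?thesis
              \<comment> \<open>Here \<open>t = x\<close>: nothing lies above the greatest point, so
                the condition is vacuous.\<close>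
              using xS(1) sub anti by blast
          qed
          then obtain t where t: "t \<in> S" "\<forall>y'. (t, y') \<in> r - Id \<longrightarrow> 1 - k < g2 y'"
            by blast
          obtain T where T: "openin Y T" "b \<in> T" "\<forall>y\<in>T. (y, s) \<in> r - Id \<or> (t, y) \<in> r - Id"
            using cut_point_neighbourhood[OF s(1)[unfolded r_def] t(1)] unfolding r_def by blast
          have "T \<subseteq> {y \<in> S. f y < k}"
            using T(3) s(2) t(2) f_lt_iff[OF _ 2(2)] openin_subset[OF T(1)] by blast
          with T(1,2) b show ?thesis
            by blast
        next
          case low_side: 2
          then obtain t where t: "(y, t) \<in> r - Id" "\<forall>y'. (y', t) \<in> r - Id \<longrightarrow> g1 y' < k"
            using g1_lt[OF y(1)] by blast
          obtain T where T: "openin Y T" "y \<in> T" "\<forall>y'\<in>T. (y', t) \<in> r - Id"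
            using low[OF t(1) low_side(1)] by blast
          have "T \<subseteq> {y \<in> S. f y < k}"
            using T(3) t(2) f_lt_iff[OF _ 2(2)] openin_subset[OF T(1)] by blast
          with T(1,2) show ?thesis
            by blast
        next
          case high_side: 3
          obtain s where s: "(s, y) \<in> r - Id" "\<forall>y'. (s, y') \<in> r - Id \<longrightarrow> 1 - k < g2 y'"
            using g2_gt[OF y(1) _ high_side] 2(2) by auto
          have "{y. (s, y) \<in> r - Id} \<subseteq> {y \<in> S. f y < k}"
            using s(2) f_lt_iff[OF _ 2(2)] sub by blast
          moreover have "s \<in> S"
            using s(1) sub by auto
          ultimately show ?thesis
            using up[of s] s(1) by blast
        qed
      qed
    qed
  qed
  \<comment> \<open>\<open>g1\<close> and \<open>g2\<close> are monotone for the cut at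
    \<open>b\<close>, which varies with the arc, whereas one norm needs one order: the cut at
    \<open>z\<close>.\<close>
  have "bv_on S (cut_order S R z) g1"
    using g1(1,2,3) unfolding r_def by (rule bv_on_cut_order[OF z ab(2)])
  moreover have "bv_on S (cut_order S R z) g2"
    using g2(1,2,3) unfolding r_def by (rule bv_on_cut_order[OF z ab(2)])
  ultimately have "bv_on S (cut_order S R z) f"
    by (rule bv_on_cong[OF bv_on_diff]) (simp add: f_def)
  moreover have "f y = 0" if y: "y \<in> S - open_arc a b" for y
  proof -
    have "y = b \<or> y = a \<or> (a, y, b) \<in> R" "y \<in> S"
      using y by (auto simp: circular_interval_def)
    then consider "y = b" | "a \<noteq> b" "(a, y) \<in> r"
      using ab refl[OF ab(1)] cyclic distinct[of a y b] unfolding r_def cut_order_def mem_Collect_eq prod.case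
      by metis
    then show ?thesis
    proof cases
      case 2
      then have "g2 y = 1"
        using g2(5) by blast
      \<comment> \<open>With \<open>g2 y = 1\<close> the two bounds squeeze \<open>f y\<close> to
        0.\<close>
      moreover have "g1 y \<le> 1" "0 \<le> f y"
        using g1(2) f_bounds(1)[OF \<open>y \<in> S\<close>] by auto
      ultimately show ?thesis
        by (simp add: f_def)
    qed (simp add: f_b)
  qed
  ultimately show ?thesis
    using continuous_f f_x by blast
qed

lemma bv_separated_cut_order:
  assumes "z \<in> S"
  shows "bv_separated Y (cut_order S R z)"
  unfolding bv_separated_def
proof (intro conjI allI impI)
  show "linear_order_on S (cut_order S R z)"
    by (rule linear_order_cut_order[OF assms])
  show "t0_space Y"
    unfolding t0_space_def
  proof (intro ballI impI)
    fix x y assume xy: "x \<in> S" "y \<in> S" "x \<noteq> y"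
    \<comment> \<open>An arc with equal ends is the complement of one point, so points are even
      closed.\<close>
    have "x \<in> open_arc y y"
      using xy distinct[of y x y] by (auto simp: circular_interval_def)
    moreover have "y \<notin> open_arc y y"
      by (simp add: circular_interval_def)
    ultimately show "\<exists>U. openin Y U \<and> (x \<notin> U) = (y \<in> U)"
      using openin_arc[OF xy(2,2)] by blast
  qed
  fix U x assume "openin Y U \<and> x \<in> U"
  then have U: "openin Y U" "x \<in> U"
    by auto
  then show "\<exists>f. continuous_map Y euclideanreal f \<and> bv_on S (cut_order S R z) f \<and> f x = 1 \<and>
      (\<forall>y\<in>S - U. f y = 0)"
  proof (cases rule: openin_base)
    case 1
    then show ?thesis
      by (intro exI[of _ "\<lambda>_. 1"]) (simp add: bv_on_const)
  next
    case (2 a b)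
    from bump[OF assms 2(1,2,3)] 2(4) show ?thesis
      by blast
  qed
qed

end

lemma COTS_bv_separated:
  assumes "COTS Y"
  shows "\<exists>L. bv_separated Y L"
proof -
  obtain R where "circular_order_on (topspace Y) R"
    "openin Y = arbitrary union_of (\<lambda>U. U \<in> circular_base (topspace Y) R)"
    using assms unfolding COTS_def by blast
  then interpret circular_space Y R
    by unfold_locales
  show ?thesis
  \<comment> \<open>The empty space has no point at which to cut.\<close>
  proof (cases "topspace Y = {}")
    case True
    then have "bv_separated Y {}"
      using openin_subset[of Y]
      by (auto simp: bv_separated_def t0_space_def order_on_defs refl_on_def)
    then show ?thesis ..
  next
    case False
    then show ?thesis
      using bv_separated_cut_order by blast
  qed
qed

theorem proposition13p4:
  fixes X :: "'a topology"
  assumes "GCOTS TYPE('b) X \<or> GLOTS TYPE('c) X"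
  shows "WRN X"
  using assms
proof
  assume "GCOTS TYPE('b) X"
  then obtain Y :: "'b topology" where "COTS Y" "embeds_in X Y"
    by (auto simp: GCOTS_def)
  then show ?thesis
    using COTS_bv_separated WRN_if_embeds_in_bv_separated by blast
next
  assume "GLOTS TYPE('c) X"
  then obtain Y :: "'c topology" where "LOTS Y" "embeds_in X Y"
    by (auto simp: GLOTS_def)
  then show ?thesis
    using LOTS_bv_separated WRN_if_embeds_in_bv_separated by blast
qed

end
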